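(* Not all groups with logspace normal forms are residually finite; that is, there exists a finitely generated group which has a logspace normal form and which is not residually finite.
   Context: A deterministic logspace transducer is a deterministic machine with a finite state control and three tapes: a read-only input tape storing the input word; a read-write work tape restricted to at most $c\log n$ squares, where $n$ is the length of the input word and $c$ is a fixed constant; and a write-only output tape written from left to right. In each transition it may modify the work tape, change state, move the input read-head, and write at most a fixed constant number of letters to the output tape. For finite alphabets $X,Y$, a function $f:X^*\to Y^*$ is logspace computable if some deterministic logspace transducer outputs $f(w)$ on every input $w\in X^*$ ($X^*$ is the set of finite words over $X$, including the empty word $\lambda$). Let $G$ be a group with finite symmetric (closed under inverses) generating set $X$; for $w\in X^*$ let $\overline{w}\in G$ denote the element it represents. A normal form for $(G,X)$ is a subset $L\subseteq X^*$ such that $w\mapsto\overline{w}$ restricts to a bijection $L\to G$. A logspace normal form function for $(G,X)$ is a logspace computable $f:X^*\to X^*$ such that, for some normal form $L$, $f(w)$ is the unique element of $L$ with $\overline{f(w)}=\overline{w}$, for all $w\in X^*$. $(G,X)$ has a logspace normal form if it has a logspace normal form function; $G$ has a logspace normal form if $(G,X)$ does for some finite symmetric generating set $X$. *)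

theory Defs
  imports Complex_Main "HOL-Algebra.Coset" "HOL-Algebra.Generated_Groups"
begin

datatype move = Move_Left | Stay | Move_Right

text \<open>
  The input word is enclosed by two end markers, so that the machine can detect both ends.
\<close>

datatype 'x input_symbol = Left_End | Letter 'x | Right_End

text \<open>
  A value \<open>Some (q, a, d, e, ys)\<close> of \<open>trans\<close> says: go to state \<open>q\<close>, replace the scanned work symbol
  by \<open>a\<close>, move the input head by \<open>d\<close> and the work head by \<open>e\<close>, and append \<open>ys\<close> to the output.
  The value \<open>None\<close> says that the machine halts.
\<close>

record ('q, 'g, 'x, 'y) transducer =
  states :: "'q set"
  work_alphabet :: "'g set"
  start :: 'q
  blank :: 'g
  trans :: "'q \<Rightarrow> 'x input_symbol \<Rightarrow> 'g \<Rightarrow> ('q \<times> 'g \<times> move \<times> move \<times> 'y list) option"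

definition input_symbols :: "'x set \<Rightarrow> 'x input_symbol set" where
  "input_symbols X = {Left_End, Right_End} \<union> Letter ` X"

text \<open>
  Only finitely many transitions are relevant when \<open>X\<close> is finite, so the number of letters written
  in one step is automatically bounded by a constant.
\<close>

definition is_transducer ::
    "'x set \<Rightarrow> 'y set \<Rightarrow> ('q, 'g, 'x, 'y) transducer \<Rightarrow> bool" where
  "is_transducer X Y M \<longleftrightarrow>
     finite (states M) \<and> finite (work_alphabet M) \<and>
     start M \<in> states M \<and> blank M \<in> work_alphabet M \<and>
     (\<forall>q \<in> states M. \<forall>s \<in> input_symbols X. \<forall>a \<in> work_alphabet M.
        \<forall>q' a' d e ys. trans M q s a = Some (q', a', d, e, ys) \<longrightarrow>
          q' \<in> states M \<and> a' \<in> work_alphabet M \<and> ys \<in> lists Y)"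

text \<open>
  The work tape is one-way infinite, with squares numbered from \<open>0\<close>. Position \<open>0\<close> of the input head
  is the left end marker, position \<open>i\<close> with \<open>1 \<le> i \<le> n\<close> is the \<open>i\<close>-th letter, and position
  \<open>n + 1\<close> is the right end marker. A head told to move off the end of its tape stays where it is.
\<close>

record ('q, 'g, 'y) config =
  state :: 'q
  input_pos :: nat
  work_tape :: "nat \<Rightarrow> 'g"
  work_pos :: nat
  output_tape :: "'y list"

definition scanned_input :: "'x list \<Rightarrow> nat \<Rightarrow> 'x input_symbol" where
  "scanned_input w i =
     (if i = 0 then Left_End else if i \<le> length w then Letter (w ! (i - 1)) else Right_End)"

fun move_head :: "move \<Rightarrow> nat \<Rightarrow> nat" where
  "move_head Move_Left i = i - 1"
| "move_head Stay i = i"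
| "move_head Move_Right i = i + 1"

definition initial_config :: "('q, 'g, 'x, 'y) transducer \<Rightarrow> ('q, 'g, 'y) config" where
  "initial_config M =
     \<lparr>state = start M, input_pos = 0, work_tape = (\<lambda>_. blank M), work_pos = 0, output_tape = []\<rparr>"

definition next_config ::
    "('q, 'g, 'x, 'y) transducer \<Rightarrow> 'x list \<Rightarrow> ('q, 'g, 'y) config \<Rightarrow> ('q, 'g, 'y) config option"
  where
  "next_config M w C =
     (case trans M (state C) (scanned_input w (input_pos C)) (work_tape C (work_pos C)) of
        None \<Rightarrow> None
      | Some (q, a, d, e, ys) \<Rightarrow>
          Some \<lparr>state = q,
                input_pos = min (length w + 1) (move_head d (input_pos C)),
                work_tape = (work_tape C)(work_pos C := a),
                work_pos = move_head e (work_pos C),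
                output_tape = output_tape C @ ys\<rparr>)"

definition reachable_config ::
    "('q, 'g, 'x, 'y) transducer \<Rightarrow> 'x list \<Rightarrow> ('q, 'g, 'y) config \<Rightarrow> bool" where
  "reachable_config M w C \<longleftrightarrow> (\<lambda>C C'. next_config M w C = Some C')\<^sup>*\<^sup>* (initial_config M) C"

definition outputs :: "('q, 'g, 'x, 'y) transducer \<Rightarrow> 'x list \<Rightarrow> 'y list \<Rightarrow> bool" where
  "outputs M w v \<longleftrightarrow> (\<exists>C. reachable_config M w C \<and> next_config M w C = None \<and> output_tape C = v)"

text \<open>
  Squares \<open>0, \<dots>, work_pos C\<close> are in use in configuration \<open>C\<close>. The bound is stated with \<open>n + 2\<close>
  in place of \<open>n\<close> so that it is positive for inputs of length \<open>0\<close> and \<open>1\<close>; for \<open>n \<ge> 2\<close> we have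
  \<open>log n \<le> log (n + 2) \<le> 2 log n\<close>, so this only affects the constant.
\<close>

definition logspace_transducer ::
    "'x set \<Rightarrow> 'y set \<Rightarrow> ('q, 'g, 'x, 'y) transducer \<Rightarrow> bool" where
  "logspace_transducer X Y M \<longleftrightarrow>
     is_transducer X Y M \<and>
     (\<exists>c::real. \<forall>w \<in> lists X. \<forall>C. reachable_config M w C \<longrightarrow>
        real (work_pos C + 1) \<le> c * log 2 (real (length w + 2)))"

text \<open>
  States and work symbols are taken from \<open>nat\<close>: there are only finitely many of each, so this is no
  restriction. Only the values of \<open>f\<close> on \<open>lists X\<close> matter.
\<close>

definition logspace_computable :: "'x set \<Rightarrow> 'y set \<Rightarrow> ('x list \<Rightarrow> 'y list) \<Rightarrow> bool" where
  "logspace_computable X Y f \<longleftrightarrow>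
     (\<exists>M :: (nat, nat, 'x, 'y) transducer.
        logspace_transducer X Y M \<and> (\<forall>w \<in> lists X. outputs M w (f w)))"


definition finite_symmetric_generating_set :: "('a, 'b) monoid_scheme \<Rightarrow> 'a set \<Rightarrow> bool" where
  "finite_symmetric_generating_set G X \<longleftrightarrow>
     finite X \<and> X \<subseteq> carrier G \<and> (\<forall>x \<in> X. inv\<^bsub>G\<^esub> x \<in> X) \<and> generate G X = carrier G"

definition word_value :: "('a, 'b) monoid_scheme \<Rightarrow> 'a list \<Rightarrow> 'a" where
  "word_value G w = foldr (mult G) w \<one>\<^bsub>G\<^esub>"

definition normal_form :: "('a, 'b) monoid_scheme \<Rightarrow> 'a set \<Rightarrow> 'a list set \<Rightarrow> bool" where
  "normal_form G X L \<longleftrightarrow> L \<subseteq> lists X \<and> bij_betw (word_value G) L (carrier G)"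

definition logspace_normal_form_function ::
    "('a, 'b) monoid_scheme \<Rightarrow> 'a set \<Rightarrow> ('a list \<Rightarrow> 'a list) \<Rightarrow> bool" where
  "logspace_normal_form_function G X f \<longleftrightarrow>
     logspace_computable X X f \<and>
     (\<exists>L. normal_form G X L \<and>
        (\<forall>w \<in> lists X. f w \<in> L \<and> word_value G (f w) = word_value G w))"

definition has_logspace_normal_form :: "('a, 'b) monoid_scheme \<Rightarrow> bool" where
  "has_logspace_normal_form G \<longleftrightarrow>
     (\<exists>X. finite_symmetric_generating_set G X \<and> (\<exists>f. logspace_normal_form_function G X f))"


definition finitely_generated_group :: "('a, 'b) monoid_scheme \<Rightarrow> bool" where
  "finitely_generated_group G \<longleftrightarrow>
     group G \<and> (\<exists>X. finite X \<and> X \<subseteq> carrier G \<and> generate G X = carrier G)"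

definition residually_finite :: "('a, 'b) monoid_scheme \<Rightarrow> bool" where
  "residually_finite G \<longleftrightarrow>
     (\<forall>g \<in> carrier G. g \<noteq> \<one>\<^bsub>G\<^esub> \<longrightarrow>
        (\<exists>N. N \<lhd> G \<and> finite (carrier (G Mod N)) \<and> g \<notin> N))"

text \<open>
  A finitely generated group is countable, hence isomorphic to a group whose carrier is a set of
  natural numbers; so an existence statement about finitely generated groups may be made about
  groups of type \<open>nat monoid\<close>.
\<close>

end

theory Submission
  imports Defs "HOL-Algebra.Multiplicative_Group" "HOL-Algebra.Weak_Morphisms"
    "HOL-Library.Countable_Set"
begin

text \<open>
  The witness is the wreath product of a finite non-commutative permutation group \<open>P\<close> with
  \<open>\<int>\<close>: a line of lamps, finitely many of them carrying a nontrivial element of \<open>P\<close>, and an element \<open>t\<close>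
  that shifts the line.

  It is not residually finite. In a finite quotient some power \<open>t\<^sup>k\<close> with \<open>k > 0\<close> becomes trivial, so
  a lamp \<open>b\<close> at position \<open>0\<close> gets the same image as its conjugate \<open>t\<^sup>k b t\<^sup>-\<^sup>k\<close>. That conjugate sits at
  position \<open>k\<close> and therefore commutes with every lamp \<open>a\<close> at position \<open>0\<close>. Hence the commutator of
  \<open>a\<close> and \<open>b\<close> dies in every finite quotient (\<open>not_residually_finite_if_conjugates_commute\<close>).

  It has a logspace normal form. Write an element as the product of the words \<open>t\<^sup>p h t\<^sup>-\<^sup>p\<close> over the
  positions \<open>p\<close> with a nontrivial lamp \<open>h\<close>, taken in a fixed order, followed by a power of \<open>t\<close>.
  For an input word of length \<open>n\<close> only positions with \<open>\<bar>p\<bar> \<le> n\<close> matter, and the lamp at \<open>p\<close>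
  is found by reading the word once while counting how far its prefixes shift the line relative to \<open>p\<close>.
  So the normal form is computed by a two-way machine with finitely many states and a single integer
  counter, which stays linear in \<open>n\<close> (\<open>lamp_nf_run\<close>). While a conjugate is printed, the input
  head itself remembers \<open>\<bar>p\<bar>\<close>, so that no second counter is needed.

  A one-counter machine whose counter is polynomially bounded is simulated in logarithmic space
  (\<open>logspace_computable_if_counter_machine\<close>). The counter is kept on the work tape in binary with the
  digits \<open>-1, 0, 1\<close>. With these digits increments and decrements are the same left-to-right sweep,
  the sign needs no storage, and the counter is zero exactly if all its digits are zero.

  Finally, a group with a logspace normal form is countable, so the wreath product can be copied to a
  set of natural numbers; normal forms survive this renaming of the letters.
\<close>

section \<open>Renaming the letters, states and work symbols of a transducer\<close>

text \<open>
  The type classes of \<open>'q\<close> and \<open>'g\<close> make a machine over convenient types of states and work symbols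
  into one over \<open>nat\<close>; \<open>dec\<close> and \<open>enc\<close> rename the input and the output letters.
\<close>

definition relabel ::
    "('x2 \<Rightarrow> 'x) \<Rightarrow> ('y \<Rightarrow> 'y2) \<Rightarrow> ('q::countable, 'g::countable, 'x, 'y) transducer
      \<Rightarrow> (nat, nat, 'x2, 'y2) transducer" where
  "relabel dec enc M =
     \<lparr>states = to_nat ` states M, work_alphabet = to_nat ` work_alphabet M,
      start = to_nat (start M), blank = to_nat (blank M),
      trans = (\<lambda>q s a. map_option (\<lambda>(q', a', d, e, ys). (to_nat q', to_nat a', d, e, map enc ys))
        (trans M (from_nat q) (map_input_symbol dec s) (from_nat a)))\<rparr>"

definition relabel_config ::
    "('y \<Rightarrow> 'y2) \<Rightarrow> ('q::countable, 'g::countable, 'y) config \<Rightarrow> (nat, nat, 'y2) config" where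
  "relabel_config enc C =
     \<lparr>state = to_nat (state C), input_pos = input_pos C, work_tape = to_nat \<circ> work_tape C,
      work_pos = work_pos C, output_tape = map enc (output_tape C)\<rparr>"

lemma scanned_input_map:
  "scanned_input (map dec w) i = map_input_symbol dec (scanned_input w i)"
  by (auto simp: scanned_input_def)

text \<open>
  The renamed machine runs in lockstep with the original one, so output and space are preserved.
\<close>

lemma next_config_relabel:
  "next_config (relabel dec enc M) w (relabel_config enc C) =
     map_option (relabel_config enc) (next_config M (map dec w) C)"
  by (auto simp: next_config_def relabel_def relabel_config_def scanned_input_map fun_eq_iff
      split: option.splits)

lemma reachable_relabel:
  assumes "reachable_config M (map dec w) C"
  shows "reachable_config (relabel dec enc M) w (relabel_config enc C)"
  using assms unfolding reachable_config_def
proof (induction rule: rtranclp_induct)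
  case base
  then show ?case
    by (simp add: initial_config_def relabel_def relabel_config_def comp_def)
next
  case (step C C')
  then show ?case
    using next_config_relabel[of dec enc M w C] by (auto intro: rtranclp.rtrancl_into_rtrancl)
qed

lemma reachable_relabelD:
  assumes "reachable_config (relabel dec enc M) w D"
  shows "\<exists>C. reachable_config M (map dec w) C \<and> D = relabel_config enc C"
  using assms unfolding reachable_config_def
proof (induction rule: rtranclp_induct)
  case base
  then show ?case
    by (intro exI[of _ "initial_config M"])
      (simp add: initial_config_def relabel_def relabel_config_def comp_def)
next
  case (step D D')
  then obtain C C' where C: "(\<lambda>C C'. next_config M (map dec w) C = Some C')\<^sup>*\<^sup>* (initial_config M) C"
      "next_config M (map dec w) C = Some C'" "D' = relabel_config enc C'"
    using next_config_relabel[of dec enc M w] by auto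
  show ?case using rtranclp.rtrancl_into_rtrancl[OF C(1,2)] C(3) by blast
qed

lemma map_input_symbol_in:
  "s \<in> input_symbols X' \<Longrightarrow> dec ` X' \<subseteq> X \<Longrightarrow> map_input_symbol dec s \<in> input_symbols X"
  by (auto simp: input_symbols_def)

lemma is_transducer_relabel:
  assumes "is_transducer X Y M" "dec ` X' \<subseteq> X" "enc ` Y \<subseteq> Y'"
  shows "is_transducer X' Y' (relabel dec enc M)"
proof -
  have "q' \<in> to_nat ` states M \<and> a' \<in> to_nat ` work_alphabet M \<and> ys \<in> lists Y'"
    if q: "q \<in> states M" and s: "s \<in> input_symbols X'" and a: "a \<in> work_alphabet M"
      and step: "trans (relabel dec enc M) (to_nat q) s (to_nat a) = Some (q', a', d, e, ys)"
    for q s a q' a' d e ys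
  proof -
    obtain p b zs where "trans M q (map_input_symbol dec s) a = Some (p, b, d, e, zs)"
        "q' = to_nat p" "a' = to_nat b" "ys = map enc zs"
      using step by (auto simp: relabel_def)
    moreover from this(1) have "p \<in> states M \<and> b \<in> work_alphabet M \<and> zs \<in> lists Y"
      using q map_input_symbol_in[OF s assms(2)] a assms(1) unfolding is_transducer_def by blast
    ultimately show ?thesis using assms(3) by (auto simp: image_subset_iff)
  qed
  then show ?thesis
    using assms(1) unfolding is_transducer_def by (auto simp: relabel_def)
qed

theorem logspace_computable_relabel:
  fixes M :: "('q::countable, 'g::countable, 'x, 'y) transducer"
  assumes M: "logspace_transducer X Y M" "\<forall>w\<in>lists X. outputs M w (f w)"
    and dec: "dec ` X' \<subseteq> X" and enc: "enc ` Y \<subseteq> Y'"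
  shows "logspace_computable X' Y' (\<lambda>w. map enc (f (map dec w)))"
  unfolding logspace_computable_def
proof (intro exI[of _ "relabel dec enc M"] conjI ballI)
  have in_X: "map dec w \<in> lists X" if "w \<in> lists X'" for w
    using that dec by (auto simp: image_subset_iff)
  obtain c where c: "\<And>w C. w \<in> lists X \<Longrightarrow> reachable_config M w C \<Longrightarrow>
      real (work_pos C + 1) \<le> c * log 2 (real (length w + 2))"
    using M(1) unfolding logspace_transducer_def by blast
  have "real (work_pos D + 1) \<le> c * log 2 (real (length w + 2))"
    if "w \<in> lists X'" "reachable_config (relabel dec enc M) w D" for w D
    using reachable_relabelD[OF that(2)] c[OF in_X[OF that(1)]] by (auto simp: relabel_config_def)
  then show "logspace_transducer X' Y' (relabel dec enc M)"
    using is_transducer_relabel[OF _ dec enc] M(1) unfolding logspace_transducer_def by blast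
  fix w assume "w \<in> lists X'"
  then obtain C where "reachable_config M (map dec w) C" "next_config M (map dec w) C = None"
      "output_tape C = f (map dec w)"
    using M(2) in_X unfolding outputs_def by blast
  then show "outputs (relabel dec enc M) w (map enc (f (map dec w)))"
    unfolding outputs_def
    using reachable_relabel[of M dec w C enc] next_config_relabel[of dec enc M w C]
    by (intro exI[of _ "relabel_config enc C"]) (simp add: relabel_config_def)
qed

section \<open>One-counter two-way transducers\<close>

text \<open>
  The Boolean argument tells whether the counter is zero, which is all that the machine can see of it;
  the integer in the result is the amount added to the counter. A configuration consists of
  state, position of the input head, counter and output.
\<close>

type_synonym ('q, 'x, 'y) counter_rules =
  "'q \<Rightarrow> 'x input_symbol \<Rightarrow> bool \<Rightarrow> ('q \<times> move \<times> int \<times> 'y list) option"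

type_synonym ('q, 'y) counter_config = "'q \<times> nat \<times> int \<times> 'y list"

fun counter_next ::
    "('q, 'x, 'y) counter_rules \<Rightarrow> 'x list \<Rightarrow> ('q, 'y) counter_config
      \<Rightarrow> ('q, 'y) counter_config option" where
  "counter_next \<delta> w (q, i, v, out) =
     (case \<delta> q (scanned_input w i) (v = 0) of
        None \<Rightarrow> None
      | Some (q', d, c, ys) \<Rightarrow> Some (q', min (length w + 1) (move_head d i), v + c, out @ ys))"

text \<open>
  Only the value of the counter after the step is bounded, since a run starts with the counter at \<open>0\<close>.
\<close>

definition counter_step ::
    "('q, 'x, 'y) counter_rules \<Rightarrow> 'x list \<Rightarrow> int \<Rightarrow> ('q, 'y) counter_config
      \<Rightarrow> ('q, 'y) counter_config \<Rightarrow> bool" where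
  "counter_step \<delta> w b C C' \<longleftrightarrow> counter_next \<delta> w C = Some C' \<and> \<bar>fst (snd (snd C'))\<bar> \<le> b"

section \<open>Signed binary counters\<close>

text \<open>
  Least significant digit first.
\<close>

fun digits_value :: "int list \<Rightarrow> int" where
  "digits_value [] = 0"
| "digits_value (d # ds) = d + 2 * digits_value ds"

text \<open>
  The argument \<open>c\<close> is the carry. Each digit is rewritten using only the carry and the digit itself,
  so that a single sweep of a work head can carry out the addition.
\<close>

fun add_digit :: "int \<Rightarrow> int list \<Rightarrow> int list" where
  "add_digit c [] = (if c = 0 then [] else [c])"
| "add_digit c (d # ds) =
     (if \<bar>d + c\<bar> = 2 then 0 # add_digit c ds else (d + c) # add_digit 0 ds)"

lemma digits_value_add_digit:
  assumes "c \<in> {-1, 0, 1}" "set ds \<subseteq> {-1, 0, 1}"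
  shows "digits_value (add_digit c ds) = c + digits_value ds"
  using assms by (induction ds arbitrary: c) auto

lemma set_add_digit:
  assumes "c \<in> {-1, 0, 1}" "set ds \<subseteq> {-1, 0, 1}"
  shows "set (add_digit c ds) \<subseteq> {-1, 0, 1}"
  using assms by (induction ds arbitrary: c) auto

text \<open>
  A zero value is visible digit by digit although the representation is redundant: the lowest digit
  has the parity of the value, so it is \<open>0\<close> if the value is, and the other digits follow
  by halving.
\<close>

lemma digits_value_eq_0_iff:
  assumes "set ds \<subseteq> {-1, 0, 1}"
  shows "digits_value ds = 0 \<longleftrightarrow> (\<forall>d\<in>set ds. d = 0)"
  using assms
proof (induction ds)
  case (Cons d ds)
  have "d + 2 * digits_value ds = 0 \<Longrightarrow> d = 0" using Cons.prems by auto presburger+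
  then show ?case using Cons by auto
qed simp

lemma add_digit_0 [simp]: "set ds \<subseteq> {-1, 0, 1} \<Longrightarrow> add_digit 0 ds = ds"
  by (induction ds) auto

text \<open>
  The representation grows only when the carry passes all digits. The new value is then a signed power
  of two, which ties the number of digits to the largest absolute value that the counter reaches.
\<close>

lemma length_add_digit:
  assumes "c \<in> {-1, 0, 1}" "set ds \<subseteq> {-1, 0, 1}"
  shows "length (add_digit c ds) = length ds \<or>
    length (add_digit c ds) = Suc (length ds) \<and> digits_value (add_digit c ds) = c * 2 ^ length ds \<and> c \<noteq> 0"
  using assms
proof (induction ds arbitrary: c)
  case (Cons d ds)
  then show ?case using Cons.IH[of c] by auto
qed auto

section \<open>Compiling counter machines to logspace transducers\<close>

text \<open>
  In state \<open>Ready q z\<close> the work head returns to square \<open>0\<close> and then executes the rule for \<open>q\<close>, where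
  \<open>z\<close> tells whether the counter is zero. In state \<open>Sweep q c z\<close> it moves away from square \<open>0\<close> with carry
  \<open>c\<close>, where \<open>z\<close> tells whether all digits written so far are zero.
\<close>

datatype 'q sim_state = Ready 'q bool | Sweep 'q int bool

instance sim_state :: (countable) countable
  by countable_datatype

text \<open>
  The symbol \<open>2\<close> is the blank. Square \<open>0\<close> stays blank and the digits occupy the squares from \<open>1\<close> on,
  so that a blank marks both ends of the counter.
\<close>

fun sim_trans ::
    "('q, 'x, 'y) counter_rules \<Rightarrow> 'q sim_state \<Rightarrow> 'x input_symbol \<Rightarrow> int
      \<Rightarrow> ('q sim_state \<times> int \<times> move \<times> move \<times> 'y list) option" where
  "sim_trans \<delta> (Ready q z) s a =
     (if a \<noteq> 2 then Some (Ready q z, a, Stay, Move_Left, [])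
      else map_option (\<lambda>(q', d, c, ys). (Sweep q' c True, 2, d, Move_Right, ys)) (\<delta> q s z))"
| "sim_trans \<delta> (Sweep q c z) s a =
     Some (if a = 2 then
             (if c = 0 then (Ready q z, 2, Stay, Move_Left, [])
              else (Ready q False, c, Stay, Move_Left, []))
           else if \<bar>a + c\<bar> = 2 then (Sweep q c z, 0, Stay, Move_Right, [])
           else (Sweep q 0 (z \<and> a + c = 0), a + c, Stay, Move_Right, []))"

definition simulator ::
    "'q set \<Rightarrow> 'q \<Rightarrow> ('q, 'x, 'y) counter_rules \<Rightarrow> ('q sim_state, int, 'x, 'y) transducer" where
  "simulator Q q0 \<delta> =
     \<lparr>states = {x. case x of Ready q z \<Rightarrow> q \<in> Q | Sweep q c z \<Rightarrow> q \<in> Q \<and> c \<in> {-1, 0, 1}},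
      work_alphabet = {-1, 0, 1, 2}, start = Ready q0 True, blank = 2, trans = sim_trans \<delta>\<rparr>"

definition counter_rules_closed :: "'q set \<Rightarrow> 'x set \<Rightarrow> 'y set \<Rightarrow> ('q, 'x, 'y) counter_rules \<Rightarrow> bool" where
  "counter_rules_closed Q X Y \<delta> \<longleftrightarrow>
     (\<forall>q\<in>Q. \<forall>s\<in>input_symbols X. \<forall>z q' d c ys. \<delta> q s z = Some (q', d, c, ys) \<longrightarrow>
        q' \<in> Q \<and> c \<in> {-1, 0, 1} \<and> ys \<in> lists Y)"

lemma is_transducer_simulator:
  assumes "finite Q" "q0 \<in> Q" "counter_rules_closed Q X Y \<delta>"
  shows "is_transducer X Y (simulator Q q0 \<delta>)"
  unfolding is_transducer_def
proof (intro conjI ballI allI impI)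
  have "states (simulator Q q0 \<delta>) \<subseteq>
      (\<Union>q\<in>Q. range (Ready q) \<union> (\<Union>c\<in>{-1, 0, 1}. range (Sweep q c)))"
  proof
    fix x assume x: "x \<in> states (simulator Q q0 \<delta>)"
    show "x \<in> (\<Union>q\<in>Q. range (Ready q) \<union> (\<Union>c\<in>{-1, 0, 1}. range (Sweep q c)))"
    proof (cases x)
      case (Ready q z)
      then have "q \<in> Q" using x by (simp add: simulator_def)
      then show ?thesis using Ready by blast
    next
      case (Sweep q c z)
      then have "q \<in> Q \<and> c \<in> {-1, 0, 1}" using x by (simp add: simulator_def)
      then show ?thesis using Sweep by blast
    qed
  qed
  then show "finite (states (simulator Q q0 \<delta>))"
    by (rule finite_subset) (use assms(1) in simp)
next
  fix q s a q' a' d e ys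
  assume q: "q \<in> states (simulator Q q0 \<delta>)" and s: "s \<in> input_symbols X"
    and a: "a \<in> work_alphabet (simulator Q q0 \<delta>)"
    and "trans (simulator Q q0 \<delta>) q s a = Some (q', a', d, e, ys)"
  then have step: "sim_trans \<delta> q s a = Some (q', a', d, e, ys)" by (simp add: simulator_def)
  have "q' \<in> states (simulator Q q0 \<delta>) \<and> a' \<in> work_alphabet (simulator Q q0 \<delta>) \<and> ys \<in> lists Y"
  proof (cases q)
    case (Ready p z)
    show ?thesis
    proof (cases "a = 2")
      case True
      then obtain p' c where "\<delta> p s z = Some (p', d, c, ys)" "q' = Sweep p' c True" "a' = 2"
        using step Ready by auto
      moreover from this(1) have "p' \<in> Q \<and> c \<in> {-1, 0, 1} \<and> ys \<in> lists Y"
        using assms(3) s q Ready unfolding counter_rules_closed_def by (fastforce simp: simulator_def)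
      ultimately show ?thesis by (simp add: simulator_def)
    next
      case False
      then show ?thesis using step Ready q a by (simp add: simulator_def)
    qed
  next
    case (Sweep p c z)
    then have "p \<in> Q" "c = -1 \<or> c = 0 \<or> c = 1" using q by (simp_all add: simulator_def)
    moreover have "a = -1 \<or> a = 0 \<or> a = 1 \<or> a = 2" using a by (simp add: simulator_def)
    ultimately show ?thesis using step Sweep by (elim disjE) (auto simp: simulator_def)
  qed
  then show "q' \<in> states (simulator Q q0 \<delta>)" "a' \<in> work_alphabet (simulator Q q0 \<delta>)" "ys \<in> lists Y"
    by simp_all
qed (use assms in \<open>simp_all add: simulator_def\<close>)

text \<open>
  Runs of this relation record the space used along the way.
\<close>

definition bounded_step ::
    "('q, 'g, 'x, 'y) transducer \<Rightarrow> 'x list \<Rightarrow> nat \<Rightarrow> ('q, 'g, 'y) config \<Rightarrow> ('q, 'g, 'y) config \<Rightarrow> bool"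
  where "bounded_step M w k C C' \<longleftrightarrow> next_config M w C = Some C' \<and> work_pos C \<le> k"

definition digits_tape :: "int list \<Rightarrow> nat \<Rightarrow> int" where
  "digits_tape ds i = (if 1 \<le> i \<and> i \<le> length ds then ds ! (i - 1) else 2)"

lemma digits_tape_middle [simp]: "digits_tape (ps @ d # ds) (Suc (length ps)) = d"
  by (simp add: digits_tape_def)

lemma digits_tape_end [simp]: "digits_tape ps (Suc (length ps)) = 2"
  by (simp add: digits_tape_def)

lemma digits_tape_0 [simp]: "digits_tape ds 0 = 2"
  by (simp add: digits_tape_def)

lemma digits_tape_update:
  "(digits_tape (ps @ d # ds))(Suc (length ps) := e) = digits_tape (ps @ e # ds)"
  by (auto simp: digits_tape_def fun_eq_iff nth_append nth_Cons')

lemma digits_tape_extend: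
  "(digits_tape ps)(Suc (length ps) := e) = digits_tape (ps @ [e])"
  by (auto simp: digits_tape_def fun_eq_iff nth_append)

text \<open>
  A sweep that ends without a carry writes a blank on the blank square behind the digits.
\<close>

lemma digits_tape_snoc_blank [simp]: "digits_tape (ps @ [2]) = digits_tape ps"
  by (auto simp: digits_tape_def fun_eq_iff nth_append)

lemma sim_sweep:
  assumes "c \<in> {-1, 0, 1}" "set ds \<subseteq> {-1, 0, 1}" "i \<le> length w + 1"
    "length ps + length ds < k"
  shows "(bounded_step (simulator Q q0 \<delta>) w k)\<^sup>*\<^sup>*
    \<lparr>state = Sweep q c z, input_pos = i, work_tape = digits_tape (ps @ ds),
      work_pos = Suc (length ps), output_tape = out\<rparr>
    \<lparr>state = Ready q (z \<and> (\<forall>d\<in>set (add_digit c ds). d = 0)), input_pos = i,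
      work_tape = digits_tape (ps @ add_digit c ds),
      work_pos = length ps + length ds, output_tape = out\<rparr>"
  using assms
proof (induction ds arbitrary: ps c z)
  case Nil
  then show ?case
    by (intro r_into_rtranclp)
      (auto simp: bounded_step_def next_config_def simulator_def digits_tape_extend min_def)
next
  case (Cons d ds)
  let ?e = "if \<bar>d + c\<bar> = 2 then 0 else d + c" and ?c = "if \<bar>d + c\<bar> = 2 then c else 0"
    and ?z = "if \<bar>d + c\<bar> = 2 then z else z \<and> d + c = 0"
  have "d \<noteq> 2" using Cons.prems(2) by auto
  then have "bounded_step (simulator Q q0 \<delta>) w k
    \<lparr>state = Sweep q c z, input_pos = i, work_tape = digits_tape (ps @ d # ds),
      work_pos = Suc (length ps), output_tape = out\<rparr>
    \<lparr>state = Sweep q ?c ?z, input_pos = i, work_tape = digits_tape ((ps @ [?e]) @ ds),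
      work_pos = Suc (length (ps @ [?e])), output_tape = out\<rparr>"
    using Cons.prems(3,4)
    by (auto simp: bounded_step_def next_config_def simulator_def digits_tape_update min_def)
  moreover have c: "?c \<in> {-1, 0, 1}" using Cons.prems(1) by simp
  have "set ds \<subseteq> {-1, 0, 1}" "length (ps @ [?e]) + length ds < k" using Cons.prems(2,4) by simp_all
  note Cons.IH[OF c this(1) Cons.prems(3) this(2), of ?z]
  ultimately have "(bounded_step (simulator Q q0 \<delta>) w k)\<^sup>*\<^sup>*
    \<lparr>state = Sweep q c z, input_pos = i, work_tape = digits_tape (ps @ d # ds),
      work_pos = Suc (length ps), output_tape = out\<rparr>
    \<lparr>state = Ready q (?z \<and> (\<forall>d\<in>set (add_digit ?c ds). d = 0)), input_pos = i,
      work_tape = digits_tape ((ps @ [?e]) @ add_digit ?c ds),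
      work_pos = length (ps @ [?e]) + length ds, output_tape = out\<rparr>"
    by (rule converse_rtranclp_into_rtranclp)
  then show ?case by (cases "\<bar>d + c\<bar> = 2") simp_all
qed

lemma sim_return:
  assumes "set ds \<subseteq> {-1, 0, 1}" "i \<le> length w + 1" "j \<le> length ds" "length ds \<le> k"
  shows "(bounded_step (simulator Q q0 \<delta>) w k)\<^sup>*\<^sup>*
    \<lparr>state = Ready q z, input_pos = i, work_tape = digits_tape ds, work_pos = j, output_tape = out\<rparr>
    \<lparr>state = Ready q z, input_pos = i, work_tape = digits_tape ds, work_pos = 0, output_tape = out\<rparr>"
  using assms(3)
proof (induction j)
  case (Suc j)
  have "ds ! j \<in> {-1, 0, 1}" using Suc.prems assms(1) nth_mem[of j ds] by (simp only: subset_iff Suc_le_eq)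
  then have "digits_tape ds (Suc j) \<noteq> 2" using Suc.prems by (auto simp: digits_tape_def)
  then have "bounded_step (simulator Q q0 \<delta>) w k
    \<lparr>state = Ready q z, input_pos = i, work_tape = digits_tape ds, work_pos = Suc j, output_tape = out\<rparr>
    \<lparr>state = Ready q z, input_pos = i, work_tape = digits_tape ds, work_pos = j, output_tape = out\<rparr>"
    using Suc.prems assms by (auto simp: bounded_step_def next_config_def simulator_def min_def)
  then show ?case using Suc by (auto intro: converse_rtranclp_into_rtranclp)
qed simp

fun sim_config :: "('q, 'y) counter_config \<Rightarrow> int list \<Rightarrow> ('q sim_state, int, 'y) config" where
  "sim_config (q, i, v, out) ds =
     \<lparr>state = Ready q (v = 0), input_pos = i, work_tape = digits_tape ds, work_pos = 0,
      output_tape = out\<rparr>"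

lemma sim_counter_step:
  assumes step: "counter_next \<delta> w (q, i, v, out) = Some (q', i', v', out')"
    and c: "v' - v \<in> {-1, 0, 1}" and ds: "set ds \<subseteq> {-1, 0, 1}" "digits_value ds = v"
    and k: "length ds < k"
  shows "(bounded_step (simulator Q q0 \<delta>) w k)\<^sup>*\<^sup>* (sim_config (q, i, v, out) ds)
    (sim_config (q', i', v', out') (add_digit (v' - v) ds))"
proof -
  obtain d ys where d: "\<delta> q (scanned_input w i) (v = 0) = Some (q', d, v' - v, ys)"
      "i' = min (length w + 1) (move_head d i)" "out' = out @ ys"
    using step by (auto split: option.splits)
  let ?ds = "add_digit (v' - v) ds"
  let ?swept = "\<lparr>state = Ready q' (\<forall>d\<in>set ?ds. d = 0), input_pos = i',
      work_tape = digits_tape ?ds, work_pos = length ds, output_tape = out'\<rparr>"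
  have "bounded_step (simulator Q q0 \<delta>) w k (sim_config (q, i, v, out) ds)
    \<lparr>state = Sweep q' (v' - v) True, input_pos = i', work_tape = digits_tape ds,
      work_pos = 1, output_tape = out'\<rparr>"
    using d by (simp add: bounded_step_def next_config_def simulator_def fun_eq_iff)
  moreover have "(bounded_step (simulator Q q0 \<delta>) w k)\<^sup>*\<^sup>*
    \<lparr>state = Sweep q' (v' - v) True, input_pos = i', work_tape = digits_tape ds,
      work_pos = 1, output_tape = out'\<rparr> ?swept"
    using sim_sweep[OF c ds(1), of i' w "[]" k Q q0 \<delta> q' True out'] d(2) k by simp
  moreover have "(bounded_step (simulator Q q0 \<delta>) w k)\<^sup>*\<^sup>* ?swept (?swept\<lparr>work_pos := 0\<rparr>)"
    using sim_return[OF set_add_digit[OF c ds(1)], of i' w "length ds" k]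
      length_add_digit[OF c ds(1)] d(2) k by auto
  ultimately have "(bounded_step (simulator Q q0 \<delta>) w k)\<^sup>*\<^sup>* (sim_config (q, i, v, out) ds)
      (?swept\<lparr>work_pos := 0\<rparr>)"
    by (meson converse_rtranclp_into_rtranclp rtranclp_trans)
  then show ?thesis
    using digits_value_eq_0_iff[OF set_add_digit[OF c ds(1)]] digits_value_add_digit[OF c ds(1)] ds(2)
    by simp
qed

text \<open>
  The strict bound \<open>b < 2 ^ l\<close> keeps the number of digits at most \<open>l\<close>: a sweep that extends the
  counter from \<open>k\<close> to \<open>k + 1\<close> digits leaves it at \<open>2 ^ k\<close> in absolute value.
\<close>

lemma sim_counter_run:
  assumes run: "(counter_step \<delta> w b)\<^sup>*\<^sup>* (q0, 0, 0, []) C"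
    and closed: "counter_rules_closed Q X Y \<delta>" and "q0 \<in> Q" and w: "w \<in> lists X"
    and b: "b < 2 ^ l"
  shows "\<exists>ds. set ds \<subseteq> {-1, 0, 1} \<and> digits_value ds = fst (snd (snd C)) \<and> length ds \<le> l \<and>
    fst C \<in> Q \<and>
    (bounded_step (simulator Q q0 \<delta>) w (Suc l))\<^sup>*\<^sup>* (initial_config (simulator Q q0 \<delta>)) (sim_config C ds)"
  using run
proof (induction rule: rtranclp_induct)
  case base
  have "initial_config (simulator Q q0 \<delta>) = sim_config (q0, 0, 0, []) []"
    by (simp add: initial_config_def simulator_def digits_tape_def fun_eq_iff)
  then show ?case using \<open>q0 \<in> Q\<close> by (intro exI[of _ "[]"]) simp
next
  case (step C C')
  obtain q i v out where C: "C = (q, i, v, out)" by (cases C)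
  obtain q' i' v' out' where C': "C' = (q', i', v', out')" by (cases C')
  have cn: "counter_next \<delta> w (q, i, v, out) = Some (q', i', v', out')" and v': "\<bar>v'\<bar> \<le> b"
    using step.hyps(2) by (simp_all add: counter_step_def C C')
  obtain ds where ds: "set ds \<subseteq> {-1, 0, 1}" "digits_value ds = v" "length ds \<le> l" "q \<in> Q"
      "(bounded_step (simulator Q q0 \<delta>) w (Suc l))\<^sup>*\<^sup>* (initial_config (simulator Q q0 \<delta>)) (sim_config C ds)"
    using step.IH C by auto
  have s: "scanned_input w i \<in> input_symbols X"
    using w by (auto simp: scanned_input_def input_symbols_def)
  have c: "v' - v \<in> {-1, 0, 1}" and q': "q' \<in> Q"
    using cn closed ds(4) s unfolding counter_rules_closed_def
    by (auto split: option.splits) blast+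
  have val: "digits_value (add_digit (v' - v) ds) = v'"
    using digits_value_add_digit[OF c ds(1)] ds(2) by simp
  have "length (add_digit (v' - v) ds) \<le> l"
    using length_add_digit[OF c ds(1)]
  proof
    assume *: "length (add_digit (v' - v) ds) = Suc (length ds) \<and>
      digits_value (add_digit (v' - v) ds) = (v' - v) * 2 ^ length ds \<and> v' - v \<noteq> 0"
    then have "\<bar>v'\<bar> = 2 ^ length ds" using c val by (auto simp: abs_mult)
    then have "(2::int) ^ length ds < 2 ^ l" using v' b by linarith
    then show ?thesis using * by simp
  qed (use ds(3) in simp)
  then show ?case
    using ds(1,3,5) sim_counter_step[OF cn c ds(1,2), of "Suc l" Q q0] set_add_digit[OF c ds(1)] val q'
    unfolding C C' by (intro exI[of _ "add_digit (v' - v) ds"]) auto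
qed

text \<open>
  A space bound concerns all reachable configurations. As the machine is deterministic, these
  are exactly the ones on its halting run.
\<close>

lemma bounded_run_bounds_reachable:
  assumes "(bounded_step M w k)\<^sup>*\<^sup>* C Z" "next_config M w Z = None" "work_pos Z \<le> k"
    and "(\<lambda>C C'. next_config M w C = Some C')\<^sup>*\<^sup>* C D"
  shows "work_pos D \<le> k"
  using assms(1,4)
proof (induction arbitrary: D rule: converse_rtranclp_induct)
  case base
  then show ?case using assms(2,3) by (auto elim: converse_rtranclpE)
next
  case (step C C')
  from step.prems show ?case
  proof (cases rule: converse_rtranclpE)
    case base
    then show ?thesis using step.hyps(1) by (simp add: bounded_step_def)
  next
    case (step E)
    then show ?thesis using step.IH step.hyps(1) by (simp add: bounded_step_def)
  qed
qed

text \<open>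
  A counter that is polynomial in the input length has logarithmically many digits.
\<close>

theorem logspace_computable_if_counter_machine:
  fixes \<delta> :: "('q::countable, 'x, 'y) counter_rules"
  assumes Q: "finite Q" "q0 \<in> Q" and closed: "counter_rules_closed Q X Y \<delta>"
    and run: "\<And>w. w \<in> lists X \<Longrightarrow> \<exists>q i v.
      (counter_step \<delta> w ((int (length w) + 2) ^ e))\<^sup>*\<^sup>* (q0, 0, 0, []) (q, i, v, f w) \<and>
      counter_next \<delta> w (q, i, v, f w) = None"
  shows "logspace_computable X Y f"
proof -
  let ?M = "simulator Q q0 \<delta>"
  have main: "outputs ?M w (f w) \<and> (\<forall>D. reachable_config ?M w D \<longrightarrow>
      real (work_pos D + 1) \<le> (2 * real e + 3) * log 2 (real (length w + 2)))"
    if w: "w \<in> lists X" for w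
  proof -
    let ?n = "length w + 2"
    \<comment> \<open>The number \<open>a\<close> is the integer part of the logarithm of \<open>?n\<close>.\<close>
    obtain a where a: "2 ^ a \<le> ?n" "?n < 2 ^ (a + 1)"
      using ex_power_ivl1[of 2 ?n] by auto
    define l where "l = (a + 1) * e + 1"
    have "int ?n < int (2 ^ (a + 1))" using a(2) by (simp only: of_nat_less_iff)
    then have "(int (length w) + 2) ^ e \<le> (2 ^ (a + 1)) ^ e" by (intro power_mono) simp_all
    also have "\<dots> < 2 * (2 ^ (a + 1)) ^ e" by simp
    also have "\<dots> = 2 ^ l" by (simp add: l_def power_add power_mult power_mult_distrib)
    finally have b: "(int (length w) + 2) ^ e < 2 ^ l" .
    obtain q i v where
      *: "(counter_step \<delta> w ((int (length w) + 2) ^ e))\<^sup>*\<^sup>* (q0, 0, 0, []) (q, i, v, f w)"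
      "counter_next \<delta> w (q, i, v, f w) = None"
      using run[OF w] by blast
    obtain ds where ds: "(bounded_step ?M w (Suc l))\<^sup>*\<^sup>* (initial_config ?M)
        (sim_config (q, i, v, f w) ds)"
      using sim_counter_run[OF *(1) closed Q(2) w b] by blast
    have halt: "next_config ?M w (sim_config (q, i, v, f w) ds) = None"
      using *(2) by (auto simp: next_config_def simulator_def split: option.splits prod.splits)
    have "reachable_config ?M w (sim_config (q, i, v, f w) ds)"
      unfolding reachable_config_def
      by (rule mono_rtranclp[rule_format, OF _ ds]) (simp add: bounded_step_def)
    then have "outputs ?M w (f w)"
      unfolding outputs_def using halt by (intro exI[of _ "sim_config (q, i, v, f w) ds"]) simp
    moreover have "real (work_pos D + 1) \<le> (2 * real e + 3) * log 2 (real ?n)"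
      if "reachable_config ?M w D" for D
    proof -
      have "work_pos D \<le> Suc l"
        using bounded_run_bounds_reachable[OF ds halt] that
        by (simp add: reachable_config_def)
      then have "work_pos D + 1 \<le> (a + 1) * e + 3" by (simp add: l_def)
      then have "real (work_pos D + 1) \<le> (real a + 1) * real e + 3"
        by (simp flip: of_nat_le_iff[where 'a = real] add: algebra_simps)
      moreover have "real (2 ^ a) \<le> real ?n" using a(1) by (simp only: of_nat_le_iff)
      then have "real a \<le> log 2 (real ?n)" by (intro le_log_of_power) simp_all
      moreover have one: "1 \<le> log 2 (real ?n)" by simp
      ultimately have "real (work_pos D + 1) \<le> (log 2 (real ?n) + log 2 (real ?n)) * real e + 3 * log 2 (real ?n)"
        by (smt (verit, best) mult_right_mono of_nat_0_le_iff)
      then show ?thesis by (simp add: algebra_simps)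
    qed
    ultimately show ?thesis by blast
  qed
  then have "logspace_transducer X Y ?M"
    unfolding logspace_transducer_def using is_transducer_simulator[OF Q closed] by blast
  then show ?thesis
    using logspace_computable_relabel[of X Y ?M f id X id Y] main by simp
qed

section \<open>An obstruction to residual finiteness\<close>

lemma power_in_finite_index_normal:
  assumes "N \<lhd> G" "finite (carrier (G Mod N))" "t \<in> carrier G"
  shows "\<exists>k>0. (N #>\<^bsub>G\<^esub> t) [^]\<^bsub>G Mod N\<^esub> (k::nat) = \<one>\<^bsub>G Mod N\<^esub>"
proof -
  interpret N: normal N G by fact
  interpret Q: group "G Mod N" by (rule N.factorgroup_is_group)
  have "N #>\<^bsub>G\<^esub> t \<in> carrier (G Mod N)"
    using N.r_coset_hom_Mod assms(3) by (auto simp: hom_def)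
  then show ?thesis
    using Q.pow_order_eq_1 assms(2) Q.order_gt_0_iff_finite by blast
qed

text \<open>
  In a finite quotient a power of \<open>t\<close> vanishes, so \<open>b\<close> becomes equal to one of the conjugates that
  commute with \<open>a\<close>. The commutator of \<open>a\<close> and \<open>b\<close> is therefore in every normal subgroup of
  finite index.
\<close>

lemma not_residually_finite_if_conjugates_commute:
  assumes "group G" and carr: "t \<in> carrier G" "a \<in> carrier G" "b \<in> carrier G"
    and comm: "\<And>k::nat. k > 0 \<Longrightarrow>
      a \<otimes>\<^bsub>G\<^esub> (t [^]\<^bsub>G\<^esub> k \<otimes>\<^bsub>G\<^esub> b \<otimes>\<^bsub>G\<^esub> inv\<^bsub>G\<^esub> (t [^]\<^bsub>G\<^esub> k)) =
      (t [^]\<^bsub>G\<^esub> k \<otimes>\<^bsub>G\<^esub> b \<otimes>\<^bsub>G\<^esub> inv\<^bsub>G\<^esub> (t [^]\<^bsub>G\<^esub> k)) \<otimes>\<^bsub>G\<^esub> a"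
    and ncomm: "a \<otimes>\<^bsub>G\<^esub> b \<noteq> b \<otimes>\<^bsub>G\<^esub> a"
  shows "\<not> residually_finite G"
proof
  interpret group G by fact
  define g where "g = (a \<otimes>\<^bsub>G\<^esub> b) \<otimes>\<^bsub>G\<^esub> inv\<^bsub>G\<^esub> (b \<otimes>\<^bsub>G\<^esub> a)"
  have g: "g \<in> carrier G" unfolding g_def using carr by simp
  have "g \<noteq> \<one>\<^bsub>G\<^esub>"
    unfolding g_def using ncomm carr by (simp add: right_cancel inv_solve_right')
  moreover assume "residually_finite G"
  ultimately obtain N where N: "N \<lhd> G" "finite (carrier (G Mod N))" "g \<notin> N"
    using g unfolding residually_finite_def by blast
  interpret N: normal N G by fact
  interpret Q: group "G Mod N" by (rule N.factorgroup_is_group)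
  interpret h: group_hom G "G Mod N" "\<lambda>x. N #>\<^bsub>G\<^esub> x"
    by unfold_locales (rule N.r_coset_hom_Mod)
  let ?h = "\<lambda>x. N #>\<^bsub>G\<^esub> x"
  obtain k :: nat where k: "k > 0" "?h t [^]\<^bsub>G Mod N\<^esub> k = \<one>\<^bsub>G Mod N\<^esub>"
    using power_in_finite_index_normal[OF N(1,2) carr(1)] by blast
  have tk: "?h (t [^]\<^bsub>G\<^esub> k) = \<one>\<^bsub>G Mod N\<^esub>"
    using k(2) h.hom_nat_pow[OF carr(1)] by simp
  have "?h (t [^]\<^bsub>G\<^esub> k \<otimes>\<^bsub>G\<^esub> b \<otimes>\<^bsub>G\<^esub> inv\<^bsub>G\<^esub> (t [^]\<^bsub>G\<^esub> k)) = ?h b"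
    using carr h.hom_closed[OF carr(3)] by (simp only: h.hom_mult h.hom_inv tk m_closed inv_closed nat_pow_closed Q.inv_one Q.r_one Q.l_one)
  then have "?h a \<otimes>\<^bsub>G Mod N\<^esub> ?h b = ?h b \<otimes>\<^bsub>G Mod N\<^esub> ?h a"
    using arg_cong[OF comm[OF k(1)], of ?h] carr by (simp only: h.hom_mult m_closed inv_closed nat_pow_closed)
  then have "?h (a \<otimes>\<^bsub>G\<^esub> b) = ?h (b \<otimes>\<^bsub>G\<^esub> a)"
    using carr by (simp only: h.hom_mult)
  moreover have "?h g = ?h (a \<otimes>\<^bsub>G\<^esub> b) \<otimes>\<^bsub>G Mod N\<^esub> inv\<^bsub>G Mod N\<^esub> ?h (b \<otimes>\<^bsub>G\<^esub> a)"
    unfolding g_def using carr by (simp only: h.hom_mult h.hom_inv m_closed inv_closed)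
  ultimately have "?h g = \<one>\<^bsub>G Mod N\<^esub>"
    using h.hom_closed[of "b \<otimes>\<^bsub>G\<^esub> a"] carr by (simp only: Q.r_inv m_closed)
  then have "N #>\<^bsub>G\<^esub> g = N" by (simp add: FactGroup_def)
  then show False using N(3) rcos_self[OF g N.subgroup_axioms] by simp
qed

section \<open>The wreath product of a finite symmetric group with the integers\<close>

type_synonym 's lamp = "(int \<Rightarrow> 's \<Rightarrow> 's) \<times> int"

text \<open>
  A pair \<open>(a, m)\<close> stands for the permutation of \<open>\<int> \<times> 's\<close> that sends \<open>(i, x)\<close> to
  \<open>(i + m, a (i + m) x)\<close>; multiplication is composition of these permutations. Pairs make equality
  of group elements a matter of comparing lamps and displacement.
\<close>

definition lamp_group :: "'s lamp monoid" where
  "lamp_group =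
     \<lparr>carrier = {(a, m). (\<forall>p. bij (a p)) \<and> finite {p. a p \<noteq> id}},
      mult = (\<lambda>(a, m) (b, k). (\<lambda>p. a p \<circ> b (p - m), m + k)),
      one = (\<lambda>_. id, 0)\<rparr>"

lemma lamp_mult [simp]:
  "x \<otimes>\<^bsub>lamp_group\<^esub> y = (\<lambda>p. fst x p \<circ> fst y (p - snd x), snd x + snd y)"
  by (simp add: lamp_group_def case_prod_beta)

lemma lamp_one [simp]: "\<one>\<^bsub>lamp_group\<^esub> = (\<lambda>_. id, 0)"
  by (simp add: lamp_group_def)

lemma lamp_carrier:
  "x \<in> carrier lamp_group \<longleftrightarrow> (\<forall>p. bij (fst x p)) \<and> finite {p. fst x p \<noteq> id}"
  by (simp add: lamp_group_def case_prod_beta)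

lemma finite_shifted_support:
  assumes "finite {p::int. a p \<noteq> id}"
  shows "finite {p. a (p - m) \<noteq> id}"
proof -
  have "{p. a (p - m) \<noteq> id} = (\<lambda>p. p + m) ` {p. a p \<noteq> id}"
    by (auto simp: image_iff intro!: exI[of _ "_ - m"])
  then show ?thesis using assms by simp
qed

lemma lamp_mult_closed:
  assumes "x \<in> carrier lamp_group" "y \<in> carrier lamp_group"
  shows "x \<otimes>\<^bsub>lamp_group\<^esub> y \<in> carrier lamp_group"
proof -
  have "{p. fst x p \<circ> fst y (p - snd x) \<noteq> id}
      \<subseteq> {p. fst x p \<noteq> id} \<union> {p. fst y (p - snd x) \<noteq> id}" by auto
  moreover have "finite ({p. fst x p \<noteq> id} \<union> {p. fst y (p - snd x) \<noteq> id})"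
    using assms finite_shifted_support by (auto simp: lamp_carrier)
  ultimately show ?thesis
    using assms by (auto simp: lamp_carrier bij_comp intro: finite_subset)
qed

lemma lamp_inverse:
  assumes "x \<in> carrier lamp_group"
  defines "y \<equiv> (\<lambda>p. Hilbert_Choice.inv (fst x (p + snd x)), - snd x)"
  shows "y \<in> carrier lamp_group" and "y \<otimes>\<^bsub>lamp_group\<^esub> x = \<one>\<^bsub>lamp_group\<^esub>"
proof -
  have b: "bij (fst x p)" for p using assms(1) by (simp add: lamp_carrier)
  have "{p. Hilbert_Choice.inv (fst x (p + snd x)) \<noteq> id} \<subseteq> {p. fst x (p - (- snd x)) \<noteq> id}"
    by (auto simp: inv_id)
  moreover have "finite {p. fst x (p - (- snd x)) \<noteq> id}"
    using assms(1) finite_shifted_support[of "fst x" "- snd x"] by (simp add: lamp_carrier)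
  ultimately show "y \<in> carrier lamp_group"
    using b by (auto simp: lamp_carrier y_def bij_imp_bij_inv intro: finite_subset)
  show "y \<otimes>\<^bsub>lamp_group\<^esub> x = \<one>\<^bsub>lamp_group\<^esub>"
    using b by (simp add: y_def bij_is_inj)
qed

lemma group_lamp_group: "group lamp_group"
proof (rule groupI)
  fix x :: "'s lamp" assume "x \<in> carrier lamp_group"
  from lamp_inverse[OF this]
  show "\<exists>y\<in>carrier lamp_group. y \<otimes>\<^bsub>lamp_group\<^esub> x = \<one>\<^bsub>lamp_group\<^esub>" by blast
qed (use lamp_mult_closed in \<open>auto simp: lamp_carrier o_assoc diff_diff_eq\<close>)

interpretation lamp: group "lamp_group :: 's lamp monoid"
  by (rule group_lamp_group)

definition shift :: "int \<Rightarrow> 's lamp" where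
  "shift k = (\<lambda>_. id, k)"

definition lamp_at :: "int \<Rightarrow> ('s \<Rightarrow> 's) \<Rightarrow> 's lamp" where
  "lamp_at p h = ((\<lambda>_. id)(p := h), 0)"

definition lamp_gens :: "'s lamp set" where
  "lamp_gens = {shift 1, shift (-1)} \<union> lamp_at 0 ` {h. bij h}"

lemma shift_carrier [simp]: "shift k \<in> carrier lamp_group"
  by (simp add: shift_def lamp_carrier)

lemma lamp_at_carrier [simp]: "bij h \<Longrightarrow> lamp_at p h \<in> carrier lamp_group"
proof -
  assume "bij h"
  moreover have "{q. ((\<lambda>_. id)(p := h)) q \<noteq> id} \<subseteq> {p}" by auto
  then have "finite {q. ((\<lambda>_. id)(p := h)) q \<noteq> id}" by (rule finite_subset) simp
  ultimately show ?thesis by (auto simp: lamp_at_def lamp_carrier)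
qed

lemma inv_shift: "inv\<^bsub>lamp_group\<^esub> shift k = shift (- k)"
  by (rule lamp.inv_equality) (simp_all only: shift_carrier, simp add: shift_def)

lemma inv_lamp_at: "bij h \<Longrightarrow> inv\<^bsub>lamp_group\<^esub> lamp_at p h = lamp_at p (Hilbert_Choice.inv h)"
  by (rule lamp.inv_equality)
    (simp_all only: lamp_at_carrier bij_imp_bij_inv, simp add: lamp_at_def fun_eq_iff bij_is_inj)

lemma shift_power: "shift 1 [^]\<^bsub>lamp_group\<^esub> (k::nat) = shift (int k)"
  by (induction k) (simp_all add: shift_def)

lemma conjugate_lamp_at:
  "shift k \<otimes>\<^bsub>lamp_group\<^esub> lamp_at p h \<otimes>\<^bsub>lamp_group\<^esub> shift (- k) = lamp_at (p + k) h"
  by (auto simp: shift_def lamp_at_def fun_eq_iff)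

lemma lamp_at_commute:
  "p \<noteq> q \<Longrightarrow> lamp_at p g \<otimes>\<^bsub>lamp_group\<^esub> lamp_at q h = lamp_at q h \<otimes>\<^bsub>lamp_group\<^esub> lamp_at p g"
  by (auto simp: lamp_at_def fun_eq_iff)

section \<open>A normal form for the wreath product\<close>

definition lamp_conjugate_word :: "int \<Rightarrow> nat \<Rightarrow> ('s \<Rightarrow> 's) \<Rightarrow> 's lamp list" where
  "lamp_conjugate_word s j h =
     (if h = id then []
      else replicate j (shift s) @ [lamp_at 0 h] @ replicate j (shift (- s)))"

text \<open>
  The normal form is printed in passes over the positions \<open>p = s * j\<close> with \<open>s = 1\<close> or \<open>s = -1\<close> and
  \<open>j\<close> increasing. A pass with \<open>mv = False\<close> prints the lamps. A pass with \<open>mv = True\<close> prints the final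
  displacement: its only contribution comes from the position equal to it. Treating the
  displacement this way lets one machine do both, and spares it from determining the sign of the
  displacement.
\<close>

definition pass_word ::
    "bool \<Rightarrow> int \<Rightarrow> 's lamp \<Rightarrow> nat \<Rightarrow> 's lamp list" where
  "pass_word mv s g j =
     (if mv then (if snd g = s * int j then replicate j (shift s) else [])
      else lamp_conjugate_word s j (fst g (s * int j)))"

text \<open>
  The three later passes begin at \<open>j = 1\<close>, since position \<open>0\<close> has been treated by the first one and a
  displacement of \<open>0\<close> is printed as the empty word.
\<close>

definition lamp_nf :: "nat \<Rightarrow> 's lamp \<Rightarrow> 's lamp list" where
  "lamp_nf n g =
     concat (map (pass_word False 1 g) [0..<Suc n]) @
     concat (map (pass_word False (-1) g) [1..<Suc n]) @
     concat (map (pass_word True 1 g) [1..<Suc n]) @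
     concat (map (pass_word True (-1) g) [1..<Suc n])"

definition bounded_by :: "nat \<Rightarrow> 's lamp \<Rightarrow> bool" where
  "bounded_by n g \<longleftrightarrow> (\<forall>p. \<bar>p\<bar> > int n \<longrightarrow> fst g p = id) \<and> \<bar>snd g\<bar> \<le> int n"

lemma word_value_Nil [simp]: "word_value G [] = \<one>\<^bsub>G\<^esub>"
  and word_value_Cons [simp]: "word_value G (x # w) = x \<otimes>\<^bsub>G\<^esub> word_value G w"
  by (simp_all add: word_value_def)

lemma (in monoid) word_value_closed [simp]:
  "set w \<subseteq> carrier G \<Longrightarrow> word_value G w \<in> carrier G"
  by (induction w) simp_all

lemma lamp_word_value_append [simp]:
  "word_value lamp_group (u @ v) = word_value lamp_group u \<otimes>\<^bsub>lamp_group\<^esub> word_value lamp_group v"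
  by (induction u) (simp_all add: o_assoc diff_diff_eq)

lemma word_value_replicate_shift:
  "word_value lamp_group (replicate j (shift s)) = shift (s * int j)"
  by (induction j) (simp_all add: shift_def algebra_simps)

lemma word_value_lamp_conjugate_word:
  "word_value lamp_group (lamp_conjugate_word s j h) = lamp_at (s * int j) h"
  by (auto simp: lamp_conjugate_word_def word_value_replicate_shift)
    (auto simp: shift_def lamp_at_def fun_eq_iff)

lemma word_value_concat_Suc:
  assumes "k \<le> n"
  shows "word_value lamp_group (concat (map F [k..<Suc n])) =
    word_value lamp_group (concat (map F [k..<n])) \<otimes>\<^bsub>lamp_group\<^esub> word_value lamp_group (F n)"
  using assms by (simp del: lamp_mult)

lemma word_value_lamp_pass:
  assumes "s \<noteq> 0"
  shows "word_value lamp_group (concat (map (pass_word False s g) [k..<n])) =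
    (\<lambda>p. if \<exists>j\<in>{k..<n}. p = s * int j then fst g p else id, 0)"
proof (induction n)
  case (Suc n)
  show ?case
  proof (cases "k \<le> n")
    case True
    then show ?thesis
      using assms unfolding word_value_concat_Suc[OF True] Suc
      by (simp add: pass_word_def word_value_lamp_conjugate_word)
        (auto simp: lamp_at_def fun_eq_iff less_Suc_eq)
  qed (simp add: fun_eq_iff)
qed (simp add: fun_eq_iff)

lemma word_value_move_pass:
  assumes "s \<noteq> 0"
  shows "word_value lamp_group (concat (map (pass_word True s g) [k..<n])) =
    shift (if \<exists>j\<in>{k..<n}. snd g = s * int j then snd g else 0)"
proof (induction n)
  case 0
  then show ?case by (simp add: shift_def)
next
  case (Suc n)
  show ?case
  proof (cases "k \<le> n")
    case True
    then show ?thesis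
      using assms unfolding word_value_concat_Suc[OF True] Suc
      by (simp add: pass_word_def word_value_replicate_shift)
        (auto simp: shift_def fun_eq_iff less_Suc_eq)
  qed (simp add: shift_def)
qed

lemma word_value_lamp_nf:
  assumes "bounded_by n g"
  shows "word_value lamp_group (lamp_nf n g) = g"
proof (rule prod_eqI)
  have s: "(\<exists>j\<in>{1..<Suc n}. m = int j) \<longleftrightarrow> m > 0 \<and> m \<le> int n"
     "(\<exists>j\<in>{0..<Suc n}. m = int j) \<longleftrightarrow> m \<ge> 0 \<and> m \<le> int n"
     "(\<exists>j\<in>{1..<Suc n}. m = - int j) \<longleftrightarrow> m < 0 \<and> m \<ge> - int n" for m
    by (auto simp: Bex_def intro: exI[of _ "nat m"] exI[of _ "nat (- m)"])
  have val: "word_value lamp_group (lamp_nf n g) =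
     (\<lambda>p. if 0 \<le> p \<and> p \<le> int n then fst g p else id, 0) \<otimes>\<^bsub>lamp_group\<^esub>
     ((\<lambda>p. if p < 0 \<and> p \<ge> - int n then fst g p else id, 0) \<otimes>\<^bsub>lamp_group\<^esub>
     (shift (if snd g > 0 \<and> snd g \<le> int n then snd g else 0) \<otimes>\<^bsub>lamp_group\<^esub>
      shift (if snd g < 0 \<and> snd g \<ge> - int n then snd g else 0)))"
    unfolding lamp_nf_def lamp_word_value_append
    by (subst word_value_lamp_pass word_value_move_pass, simp)+
      (simp only: mult_1 mult_minus1 s)
  show "fst (word_value lamp_group (lamp_nf n g)) = fst g"
    using assms unfolding val by (auto simp: bounded_by_def shift_def fun_eq_iff)
  show "snd (word_value lamp_group (lamp_nf n g)) = snd g"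
    using assms unfolding val by (auto simp: bounded_by_def shift_def)
qed

text \<open>
  Positions beyond the support contribute nothing. Hence the word depends on the group element only,
  although the machine chooses \<open>n\<close> as the length of its input.
\<close>

lemma lamp_nf_mono:
  assumes "bounded_by n g" "n \<le> N"
  shows "lamp_nf N g = lamp_nf n g"
proof -
  have "concat (map (pass_word mv s g) [k..<Suc N]) = concat (map (pass_word mv s g) [k..<Suc n])"
    if "s = 1 \<or> s = -1" "k \<le> Suc n" for mv s k
  proof -
    have "concat (map (pass_word mv s g) [Suc n..<Suc N]) = []"
      using assms(1) that(1)
      by (auto simp: pass_word_def lamp_conjugate_word_def bounded_by_def)
    moreover have "[k..<Suc N] = [k..<Suc n] @ [Suc n..<Suc N]"
      using upt_add_eq_append[OF that(2), of "N - n"] assms(2) by (simp del: upt_Suc)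
    ultimately show ?thesis by (simp del: upt_Suc)
  qed
  then show ?thesis unfolding lamp_nf_def by (simp del: upt_Suc)
qed

lemma bounded_by_exists:
  assumes "g \<in> carrier lamp_group"
  shows "\<exists>n. bounded_by n g"
proof -
  have "finite (insert (snd g) {p. fst g p \<noteq> id})" using assms by (simp add: lamp_carrier)
  then obtain B where "abs ` insert (snd g) {p. fst g p \<noteq> id} \<subseteq> {..B}"
    unfolding finite_int_iff_bounded_le by blast
  then have "bounded_by (nat B) g" by (force simp: bounded_by_def)
  then show ?thesis ..
qed

lemma lamp_gens_fst: "x \<in> lamp_gens \<Longrightarrow> p \<noteq> 0 \<Longrightarrow> fst x p = id"
  and lamp_gens_snd: "x \<in> lamp_gens \<Longrightarrow> snd x \<in> {-1, 0, 1}"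
  by (auto simp: lamp_gens_def shift_def lamp_at_def)

lemma lamp_gens_carrier: "lamp_gens \<subseteq> carrier lamp_group"
  by (auto simp: lamp_gens_def)

lemma bounded_by_word_value:
  "w \<in> lists lamp_gens \<Longrightarrow> bounded_by (length w) (word_value lamp_group w)"
proof (induction w)
  case (Cons x w)
  have "\<bar>snd x\<bar> \<le> 1" using Cons.prems lamp_gens_snd[of x] by auto
  then show ?case using Cons lamp_gens_fst[of x] by (auto simp: bounded_by_def)
qed (simp add: bounded_by_def)

lemma lamp_nf_in_gens:
  assumes "g \<in> carrier lamp_group"
  shows "lamp_nf n g \<in> lists lamp_gens"
  using assms
  by (auto simp: lamp_nf_def pass_word_def lamp_conjugate_word_def lamp_gens_def lamp_carrier
      split: if_splits)

section \<open>A one-counter machine computing the normal form\<close>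

datatype phase = Scan | Back | Out | Return | Rewind

instance phase :: finite
proof
  have "(UNIV :: phase set) = {Scan, Back, Out, Return, Rewind}"
    using phase.exhaust by blast
  then show "finite (UNIV :: phase set)" by (metis finite.emptyI finite_insert)
qed

text \<open>
  The components are the phase, the pass as the pair \<open>(mv, neg)\<close>, the lamp accumulated at the current
  position \<open>p\<close>, and whether \<open>p\<close> is the displacement of the input.
\<close>

type_synonym 's nf_state = "phase \<times> (bool \<times> bool) \<times> ('s \<Rightarrow> 's) \<times> bool"

definition dir :: "bool \<Rightarrow> int" where
  "dir neg = (if neg then -1 else 1)"

fun next_pass :: "bool \<times> bool \<Rightarrow> bool \<times> bool" where
  "next_pass (mv, neg) = (if neg then (True, False) else (mv, True))"

text \<open>
  At the start of a scan the counter holds the position \<open>p\<close> under consideration. The phase \<open>Scan\<close>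
  subtracts from it each displacement that it reads, so the counter is \<open>0\<close> exactly at the
  letters that act on the lamp at \<open>p\<close>; \<open>Back\<close> undoes the subtractions. The phase \<open>Out\<close> moves
  \<open>p\<close> from the counter into the position of the input head and prints the shifts towards \<open>p\<close>, and
  \<open>Return\<close> moves it back and prints the shifts away from \<open>p\<close>. If \<open>Out\<close> ends on the right end marker,
  then \<open>\<bar>p\<bar> = n + 1\<close> and the pass is complete; \<open>Rewind\<close> then prepares the next one. The letters are
  group elements, whose components are used directly: for a generator \<open>x\<close> one of \<open>fst x 0\<close> and
  \<open>snd x\<close> is trivial.
\<close>

fun nf_rules :: "('s nf_state, 's lamp, 's lamp) counter_rules" where
  "nf_rules (Scan, pass, h, e) s z =
     (case s of
        Left_End \<Rightarrow> Some ((Scan, pass, h, e), Move_Right, 0, [])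
      | Letter x \<Rightarrow> Some ((Scan, pass, if z then h \<circ> fst x 0 else h, e), Move_Right, - snd x, [])
      | Right_End \<Rightarrow> Some ((Back, pass, h, z), Move_Left, 0, []))"
| "nf_rules (Back, pass, h, e) s z =
     (case s of
        Letter x \<Rightarrow> Some ((Back, pass, h, e), Move_Left, snd x, [])
      | _ \<Rightarrow> Some ((Out, pass, h, e), Stay, 0, []))"
| "nf_rules (Out, (mv, neg), h, e) s z =
     (if \<not> z then
        Some ((Out, (mv, neg), h, e), Move_Right, - dir neg,
          if (if mv then e else h \<noteq> id) then [shift (dir neg)] else [])
      else if s = Right_End then
        (if mv \<and> neg then None else Some ((Rewind, next_pass (mv, neg), id, False), Stay, 0, []))
      else Some ((Return, (mv, neg), h, e), Stay, 0, if \<not> mv \<and> h \<noteq> id then [lamp_at 0 h] else []))"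
| "nf_rules (Return, (mv, neg), h, e) s z =
     (if s = Left_End then Some ((Scan, (mv, neg), id, False), Stay, dir neg, [])
      else Some ((Return, (mv, neg), h, e), Move_Left, dir neg,
        if \<not> mv \<and> h \<noteq> id then [shift (- dir neg)] else []))"
| "nf_rules (Rewind, (mv, neg), h, e) s z =
     (if s = Left_End then Some ((Scan, (mv, neg), id, False), Stay, dir neg, [])
      else Some ((Rewind, (mv, neg), h, e), Move_Left, 0, []))"

lemma lamp_gens_shift [simp]: "shift 1 \<in> lamp_gens" "shift (- 1) \<in> lamp_gens"
  by (simp_all add: lamp_gens_def)

lemma nf_rules_closed:
  "counter_rules_closed {(ph, pass, h, e). bij h} lamp_gens lamp_gens nf_rules"
proof -
  have "(case q' of (ph, pass, h, e) \<Rightarrow> bij h) \<and> c \<in> {-1, 0, 1} \<and> ys \<in> lists lamp_gens"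
    if "bij h" and s: "s \<in> input_symbols lamp_gens"
      and r: "nf_rules (ph, (mv, neg), h, e) s z = Some (q', d, c, ys)"
    for ph mv neg h e s z q' d c ys
  proof (cases ph)
    case Scan
    show ?thesis
    proof (cases s)
      case (Letter x)
      then have "x \<in> lamp_gens" using s by (auto simp: input_symbols_def)
      then have "snd x \<in> {-1, 0, 1}" "bij (fst x 0)"
        using lamp_gens_snd[of x] lamp_gens_carrier by (auto simp: lamp_carrier)
      then show ?thesis using r \<open>bij h\<close> Scan Letter by (auto simp: bij_comp)
    qed (use r \<open>bij h\<close> Scan in auto)
  next
    case Back
    show ?thesis
    proof (cases s)
      case (Letter x)
      then have "x \<in> lamp_gens" using s by (auto simp: input_symbols_def)
      then show ?thesis using r \<open>bij h\<close> Back Letter lamp_gens_snd[of x] by auto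
    qed (use r \<open>bij h\<close> Back in auto)
  next
    case Out
    moreover have "lamp_at 0 h \<in> lamp_gens" using \<open>bij h\<close> by (simp add: lamp_gens_def)
    moreover have "dir neg \<in> {-1, 1}" by (simp add: dir_def)
    ultimately show ?thesis using r \<open>bij h\<close> by (auto split: if_splits)
  next
    case Return
    moreover have "dir neg \<in> {-1, 1}" by (simp add: dir_def)
    ultimately show ?thesis using r \<open>bij h\<close> by (auto split: if_splits)
  next
    case Rewind
    moreover have "dir neg \<in> {-1, 1}" by (simp add: dir_def)
    ultimately show ?thesis using r \<open>bij h\<close> by (auto split: if_splits)
  qed
  then show ?thesis
    unfolding counter_rules_closed_def
    by (intro ballI allI impI) (simp only: mem_Collect_eq split_paired_all prod.case)
qed

text \<open>
  The bound on the counter adds up \<open>\<bar>p\<bar> \<le> n + 1\<close>, the displacement of the input, and one step for each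
  letter that \<open>Back\<close> still has to undo.
\<close>

context
  fixes w :: "'s lamp list" and b :: int
  assumes w: "w \<in> lists lamp_gens" and b: "3 * int (length w) + 2 \<le> b"
begin

abbreviation nf_run :: "('s nf_state, 's lamp) counter_config \<Rightarrow> ('s nf_state, 's lamp) counter_config \<Rightarrow> bool"
  where "nf_run \<equiv> (counter_step nf_rules w b)\<^sup>*\<^sup>*"

lemma nf_run_step:
  assumes "counter_next nf_rules w C = Some (q, i, v, out)" "\<bar>v\<bar> \<le> b" "nf_run (q, i, v, out) D"
  shows "nf_run C D"
  using assms by (intro converse_rtranclp_into_rtranclp[OF _ assms(3)]) (simp add: counter_step_def)

lemma letter_step_bound: "i < length w \<Longrightarrow> \<bar>snd (w ! i)\<bar> \<le> 1"
  using w lamp_gens_snd[of "w ! i"] nth_mem[of i w] by fastforce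

text \<open>
  The multiplication of the wreath product looks up the second factor at a position shifted by the
  displacement of the first. The counter \<open>v\<close> follows these shifts.
\<close>

lemma scan_run:
  assumes "i \<le> length w" "\<bar>v\<bar> + int (length w - i) \<le> b"
  shows "nf_run ((Scan, pass, h, e), Suc i, v, out)
    ((Scan, pass, h \<circ> fst (word_value lamp_group (drop i w)) v, e), Suc (length w),
      v - snd (word_value lamp_group (drop i w)), out)"
  using assms
proof (induction i arbitrary: v h rule: inc_induct)
  case base
  then show ?case by simp
next
  case (step i)
  let ?x = "w ! i"
  have x: "drop i w = ?x # drop (Suc i) w" using step.hyps by (simp add: Cons_nth_drop_Suc)
  have val: "fst (word_value lamp_group (drop i w)) v =
      fst ?x v \<circ> fst (word_value lamp_group (drop (Suc i) w)) (v - snd ?x)"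
    "snd (word_value lamp_group (drop i w)) =
      snd ?x + snd (word_value lamp_group (drop (Suc i) w))"
    by (simp_all add: x)
  have "?x \<in> lamp_gens" using w step.hyps by (auto simp: in_lists_conv_set)
  then have acc: "(if v = 0 then h \<circ> fst ?x 0 else h) = h \<circ> fst ?x v"
    using lamp_gens_fst[of ?x v] by simp
  have v: "\<bar>v - snd ?x\<bar> + int (length w - Suc i) \<le> b"
    using letter_step_bound[of i] step.hyps step.prems by linarith
  show ?case
  proof (rule nf_run_step)
    show "counter_next nf_rules w ((Scan, pass, h, e), Suc i, v, out) =
      Some ((Scan, pass, h \<circ> fst ?x v, e), Suc (Suc i), v - snd ?x, out)"
      using step.hyps acc by (simp add: scanned_input_def)
    show "\<bar>v - snd ?x\<bar> \<le> b" using v by linarith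
    show "nf_run ((Scan, pass, h \<circ> fst ?x v, e), Suc (Suc i), v - snd ?x, out)
      ((Scan, pass, h \<circ> fst (word_value lamp_group (drop i w)) v, e), Suc (length w),
      v - snd (word_value lamp_group (drop i w)), out)"
      using step.IH[OF v, of "h \<circ> fst ?x v"] unfolding val by (simp only: o_assoc diff_diff_eq)
  qed
qed

lemma back_run:
  assumes "i \<le> length w" "\<bar>v\<bar> + int i \<le> b"
  shows "nf_run ((Back, pass, h, e), i, v, out)
    ((Back, pass, h, e), 0, v + snd (word_value lamp_group (take i w)), out)"
  using assms
proof (induction i arbitrary: v)
  case (Suc i)
  let ?x = "w ! i"
  have x: "take (Suc i) w = take i w @ [?x]" using Suc.prems by (simp add: take_Suc_conv_app_nth)
  have v: "\<bar>v + snd ?x\<bar> + int i \<le> b" using letter_step_bound[of i] Suc.prems by linarith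
  show ?case
  proof (rule nf_run_step)
    show "counter_next nf_rules w ((Back, pass, h, e), Suc i, v, out) =
      Some ((Back, pass, h, e), i, v + snd ?x, out)"
      using Suc.prems by (simp add: scanned_input_def)
    show "\<bar>v + snd ?x\<bar> \<le> b" using v by linarith
    show "nf_run ((Back, pass, h, e), i, v + snd ?x, out)
      ((Back, pass, h, e), 0, v + snd (word_value lamp_group (take (Suc i) w)), out)"
      using Suc.IH[OF _ v] Suc.prems by (simp add: x algebra_simps)
  qed
qed simp

lemma evaluate_run:
  assumes "\<bar>p\<bar> \<le> int (length w) + 1"
  defines "g \<equiv> word_value lamp_group w"
  shows "nf_run ((Scan, pass, h, e), 0, p, out) ((Out, pass, h \<circ> fst g p, p = snd g), 0, p, out)"
proof -
  let ?n = "length w" and ?h = "h \<circ> fst g p"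
  have g: "\<bar>snd g\<bar> \<le> int ?n" using bounded_by_word_value[OF w] by (simp add: g_def bounded_by_def)
  have "nf_run ((Scan, pass, h, e), Suc 0, p, out) ((Scan, pass, ?h, e), Suc ?n, p - snd g, out)"
    using scan_run[of 0 p] assms b by (simp add: g_def)
  then have s1: "nf_run ((Scan, pass, h, e), 0, p, out)
      ((Scan, pass, ?h, e), Suc ?n, p - snd g, out)"
    by (rule nf_run_step[rotated 2]) (use assms b in \<open>simp_all add: scanned_input_def\<close>)
  have s2: "nf_run ((Scan, pass, ?h, e), Suc ?n, p - snd g, out)
      ((Back, pass, ?h, p = snd g), ?n, p - snd g, out)"
    by (rule nf_run_step[OF _ _ rtranclp.rtrancl_refl])
      (use assms(1) g b in \<open>simp_all add: scanned_input_def\<close>)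
  have s3: "nf_run ((Back, pass, ?h, p = snd g), ?n, p - snd g, out)
      ((Back, pass, ?h, p = snd g), 0, p, out)"
    using back_run[of ?n "p - snd g" pass ?h "p = snd g" out] assms(1) g b by (simp add: g_def)
  have s4: "nf_run ((Back, pass, ?h, p = snd g), 0, p, out)
      ((Out, pass, ?h, p = snd g), 0, p, out)"
    by (rule nf_run_step[OF _ _ rtranclp.rtrancl_refl])
      (use assms(1) b in \<open>simp_all add: scanned_input_def\<close>)
  show ?thesis by (rule rtranclp_trans[OF s1 rtranclp_trans[OF s2 rtranclp_trans[OF s3 s4]]])
qed

lemma out_run:
  assumes "i + j \<le> length w + 1"
  shows "nf_run ((Out, (mv, neg), h, e), i, dir neg * int j, out)
    ((Out, (mv, neg), h, e), i + j, 0,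
      out @ (if (if mv then e else h \<noteq> id) then replicate j (shift (dir neg)) else []))"
  using assms
proof (induction j arbitrary: i out)
  case (Suc j)
  let ?o = "out @ (if (if mv then e else h \<noteq> id) then [shift (dir neg)] else [])"
  show ?case
  proof (rule nf_run_step)
    show "counter_next nf_rules w ((Out, (mv, neg), h, e), i, dir neg * int (Suc j), out) =
      Some ((Out, (mv, neg), h, e), Suc i, dir neg * int j, ?o)"
      using Suc.prems by (auto simp: dir_def)
    show "\<bar>dir neg * int j\<bar> \<le> b" using Suc.prems b by (auto simp: dir_def)
    show "nf_run ((Out, (mv, neg), h, e), Suc i, dir neg * int j, ?o)
     ((Out, (mv, neg), h, e), i + Suc j, 0,
      out @ (if (if mv then e else h \<noteq> id) then replicate (Suc j) (shift (dir neg)) else []))"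
      using Suc.IH[of "Suc i" ?o] Suc.prems by (auto split: if_splits)
  qed
qed simp

lemma return_run:
  assumes "i \<le> length w + 1" "\<bar>v\<bar> + int i \<le> b"
  shows "nf_run ((Return, (mv, neg), h, e), i, v, out)
    ((Return, (mv, neg), h, e), 0, v + dir neg * int i,
      out @ (if \<not> mv \<and> h \<noteq> id then replicate i (shift (- dir neg)) else []))"
  using assms
proof (induction i arbitrary: v out)
  case (Suc i)
  let ?o = "out @ (if \<not> mv \<and> h \<noteq> id then [shift (- dir neg)] else [])"
  have v: "\<bar>v + dir neg\<bar> + int i \<le> b" using Suc.prems by (auto simp: dir_def)
  show ?case
  proof (rule nf_run_step)
    show "counter_next nf_rules w ((Return, (mv, neg), h, e), Suc i, v, out) =
      Some ((Return, (mv, neg), h, e), i, v + dir neg, ?o)"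
      using Suc.prems by (auto simp: scanned_input_def)
    show "\<bar>v + dir neg\<bar> \<le> b" using v by linarith
    show "nf_run ((Return, (mv, neg), h, e), i, v + dir neg, ?o)
     ((Return, (mv, neg), h, e), 0, v + dir neg * int (Suc i),
      out @ (if \<not> mv \<and> h \<noteq> id then replicate (Suc i) (shift (- dir neg)) else []))"
      using Suc.IH[OF _ v, of ?o] Suc.prems by (auto simp: algebra_simps split: if_splits)
  qed
qed simp

lemma rewind_run:
  assumes "i \<le> length w + 1"
  shows "nf_run ((Rewind, (mv, neg), h, e), i, 0, out) ((Scan, (mv, neg), id, False), 0, dir neg, out)"
  using assms
proof (induction i)
  case 0
  show ?case
    by (rule nf_run_step[OF _ _ rtranclp.rtrancl_refl])
      (use b in \<open>simp_all add: scanned_input_def dir_def id_def\<close>)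
next
  case (Suc i)
  show ?case
    by (rule nf_run_step[OF _ _ Suc.IH]) (use Suc.prems b in \<open>simp_all add: scanned_input_def\<close>)
qed

text \<open>
  One round of a pass: evaluate the lamp at \<open>p\<close>, print its contribution, and go on to the next position.
\<close>

lemma emit_run:
  assumes "j \<le> length w"
  defines "g \<equiv> word_value lamp_group w"
  shows "nf_run ((Scan, (mv, neg), id, False), 0, dir neg * int j, out)
    ((Scan, (mv, neg), id, False), 0, dir neg * int (Suc j), out @ pass_word mv (dir neg) g j)"
proof -
  let ?p = "dir neg * int j"
  let ?h = "fst g ?p" and ?e = "?p = snd g"
  let ?o1 = "out @ (if (if mv then ?e else ?h \<noteq> id) then replicate j (shift (dir neg)) else [])"
  let ?o2 = "?o1 @ (if \<not> mv \<and> ?h \<noteq> id then [lamp_at 0 ?h] else [])"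
  let ?o3 = "?o2 @ (if \<not> mv \<and> ?h \<noteq> id then replicate j (shift (- dir neg)) else [])"
  have p: "\<bar>?p\<bar> \<le> int (length w)" using assms(1) by (simp add: dir_def)
  have s1: "nf_run ((Scan, (mv, neg), id, False), 0, ?p, out)
      ((Out, (mv, neg), ?h, ?e), 0, ?p, out)"
    using evaluate_run[of ?p "(mv, neg)" id] p by (simp add: g_def)
  have s2: "nf_run ((Out, (mv, neg), ?h, ?e), 0, ?p, out)
      ((Out, (mv, neg), ?h, ?e), j, 0, ?o1)"
    using out_run[of 0 j mv neg ?h ?e out] assms(1) by simp
  have s3: "nf_run ((Out, (mv, neg), ?h, ?e), j, 0, ?o1)
      ((Return, (mv, neg), ?h, ?e), j, 0, ?o2)"
    by (rule nf_run_step[OF _ _ rtranclp.rtrancl_refl])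
      (use assms(1) b in \<open>simp_all add: scanned_input_def\<close>)
  have s4: "nf_run ((Return, (mv, neg), ?h, ?e), j, 0, ?o2)
      ((Return, (mv, neg), ?h, ?e), 0, ?p, ?o3)"
    using return_run[of j 0 mv neg ?h ?e ?o2] assms(1) b by simp
  have s5: "nf_run ((Return, (mv, neg), ?h, ?e), 0, ?p, ?o3)
      ((Scan, (mv, neg), id, False), 0, dir neg * int (Suc j), ?o3)"
    by (rule nf_run_step[OF _ _ rtranclp.rtrancl_refl])
      (use assms(1) b in \<open>auto simp: scanned_input_def dir_def\<close>)
  have out: "?o3 = out @ pass_word mv (dir neg) g j"
    by (auto simp: pass_word_def lamp_conjugate_word_def)
  show ?thesis
    using rtranclp_trans[OF s1 rtranclp_trans[OF s2 rtranclp_trans[OF s3 rtranclp_trans[OF s4 s5]]]] unfolding out .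
qed

text \<open>
  At position \<open>\<bar>p\<bar> = n + 1\<close> nothing is printed, because that position lies outside the support
  and differs from the displacement; the right end marker stops the pass there.
\<close>

lemma pass_run:
  assumes "j \<le> Suc (length w)"
  defines "g \<equiv> word_value lamp_group w"
  shows "nf_run ((Scan, (mv, neg), id, False), 0, dir neg * int j, out)
    ((Out, (mv, neg), id, False), Suc (length w), 0,
      out @ concat (map (pass_word mv (dir neg) g) [j..<Suc (length w)]))"
  using assms(1)
proof (induction j arbitrary: out rule: inc_induct)
  case base
  let ?n = "Suc (length w)"
  let ?p = "dir neg * int ?n"
  have "bounded_by (length w) g" unfolding g_def by (rule bounded_by_word_value[OF w])
  moreover have p: "\<bar>?p\<bar> = int (length w) + 1" by (simp add: dir_def)
  ultimately have g: "fst g ?p = id" "?p \<noteq> snd g" by (auto simp: bounded_by_def)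
  have s1: "nf_run ((Scan, (mv, neg), id, False), 0, ?p, out)
      ((Out, (mv, neg), id, False), 0, ?p, out)"
    using evaluate_run[of ?p "(mv, neg)" id False out] p g unfolding g_def[symmetric] by simp
  have s2: "nf_run ((Out, (mv, neg), id, False), 0, ?p, out)
      ((Out, (mv, neg), id, False), ?n, 0, out)"
    using out_run[of 0 ?n mv neg id False out] by (cases mv) simp_all
  show ?case using rtranclp_trans[OF s1 s2] by (simp add: id_def)
next
  case (step j)
  show ?case
    using rtranclp_trans[OF emit_run[of j mv neg out, folded g_def] step.IH] step.hyps
    by (simp add: upt_conv_Cons id_def del: upt_Suc of_nat_Suc)
qed

lemma next_pass_run:
  assumes "\<not> (mv \<and> neg)" "next_pass (mv, neg) = (mv', neg')"
  shows "nf_run ((Out, (mv, neg), id, False), Suc (length w), 0, out)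
    ((Scan, (mv', neg'), id, False), 0, dir neg', out)"
  by (rule nf_run_step[OF _ _ rewind_run[of "Suc (length w)" mv' neg' id False out]])
    (use assms b in \<open>auto simp: scanned_input_def split: if_splits\<close>)

lemma lamp_nf_run:
  "nf_run ((Scan, (False, False), id, False), 0, 0, [])
    ((Out, (True, True), id, False), Suc (length w), 0,
      lamp_nf (length w) (word_value lamp_group w))"
proof -
  let ?g = "word_value lamp_group w" and ?n = "Suc (length w)"
  let ?o1 = "concat (map (pass_word False 1 ?g) [0..<?n])"
  let ?o2 = "?o1 @ concat (map (pass_word False (-1) ?g) [1..<?n])"
  let ?o3 = "?o2 @ concat (map (pass_word True 1 ?g) [1..<?n])"
  let ?o4 = "?o3 @ concat (map (pass_word True (-1) ?g) [1..<?n])"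
  have d: "dir False = 1" "dir True = -1" by (simp_all add: dir_def)
  have s1: "nf_run ((Scan, (False, False), id, False), 0, 0, [])
      ((Out, (False, False), id, False), ?n, 0, ?o1)"
    using pass_run[of 0 False False "[]"] by (simp add: d del: upt_Suc)
  have s2: "nf_run ((Out, (False, False), id, False), ?n, 0, ?o1)
      ((Scan, (False, True), id, False), 0, -1, ?o1)"
    using next_pass_run[of False False False True ?o1] by (simp add: d del: upt_Suc)
  have s3: "nf_run ((Scan, (False, True), id, False), 0, -1, ?o1)
      ((Out, (False, True), id, False), ?n, 0, ?o2)"
    using pass_run[of 1 False True ?o1] by (simp add: d del: upt_Suc)
  have s4: "nf_run ((Out, (False, True), id, False), ?n, 0, ?o2)
      ((Scan, (True, False), id, False), 0, 1, ?o2)"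
    using next_pass_run[of False True True False ?o2] by (simp add: d del: upt_Suc)
  have s5: "nf_run ((Scan, (True, False), id, False), 0, 1, ?o2)
      ((Out, (True, False), id, False), ?n, 0, ?o3)"
    using pass_run[of 1 True False ?o2] by (simp add: d del: upt_Suc)
  have s6: "nf_run ((Out, (True, False), id, False), ?n, 0, ?o3)
      ((Scan, (True, True), id, False), 0, -1, ?o3)"
    using next_pass_run[of True False True True ?o3] by (simp add: d del: upt_Suc)
  have s7: "nf_run ((Scan, (True, True), id, False), 0, -1, ?o3)
      ((Out, (True, True), id, False), ?n, 0, ?o4)"
    using pass_run[of 1 True True ?o3] by (simp add: d del: upt_Suc)
  have out: "?o4 = lamp_nf (length w) ?g" by (simp add: lamp_nf_def del: upt_Suc)
  show ?thesis
    using rtranclp_trans[OF s1 rtranclp_trans[OF s2 rtranclp_trans[OF s3 rtranclp_trans[OF s4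
      rtranclp_trans[OF s5 rtranclp_trans[OF s6 s7]]]]]] unfolding out .
qed

end

theorem lamp_nf_logspace_computable:
  "logspace_computable (lamp_gens :: 's::finite lamp set) lamp_gens
     (\<lambda>w. lamp_nf (length w) (word_value lamp_group w))"
proof (rule logspace_computable_if_counter_machine)
  let ?Q = "{(ph, pass, h, e). bij h} :: 's nf_state set"
  show "finite ?Q" by simp
  show "(Scan, (False, False), id, False) \<in> ?Q" by simp
  show "counter_rules_closed ?Q lamp_gens lamp_gens nf_rules"
    by (rule nf_rules_closed)
  fix w :: "'s lamp list" assume w: "w \<in> lists lamp_gens"
  \<comment> \<open>A square is enough for the linear bound, and the simulation accepts any fixed exponent.\<close>
  have "3 * int (length w) + 2 \<le> (int (length w) + 2) ^ 2" by (simp add: power2_eq_square algebra_simps)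
  from lamp_nf_run[OF w this]
  show "\<exists>q i v. (counter_step nf_rules w ((int (length w) + 2) ^ 2))\<^sup>*\<^sup>*
        ((Scan, (False, False), id, False), 0, 0, [])
        (q, i, v, lamp_nf (length w) (word_value lamp_group w)) \<and>
      counter_next nf_rules w (q, i, v, lamp_nf (length w) (word_value lamp_group w)) = None"
    by (intro exI conjI) (assumption, simp add: scanned_input_def)
qed

section \<open>The wreath product has a logspace normal form\<close>

lemma (in group) word_value_in_generate:
  "w \<in> lists X \<Longrightarrow> word_value G w \<in> generate G X"
  by (induction w) (auto intro: generate.one generate.incl generate.eng)

lemma finite_symmetric_generating_set_lamp_gens:
  "finite_symmetric_generating_set lamp_group (lamp_gens :: 's::finite lamp set)"
  unfolding finite_symmetric_generating_set_def
proof (intro conjI ballI)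
  show "finite (lamp_gens :: 's lamp set)" by (simp add: lamp_gens_def)
  show gens: "(lamp_gens :: 's lamp set) \<subseteq> carrier lamp_group" by (rule lamp_gens_carrier)
  show "inv\<^bsub>lamp_group\<^esub> x \<in> lamp_gens" if "x \<in> lamp_gens" for x :: "'s lamp"
    using that by (auto simp: lamp_gens_def inv_shift inv_lamp_at bij_imp_bij_inv)
  show "generate lamp_group lamp_gens = carrier (lamp_group :: 's lamp monoid)"
  proof
    show "generate lamp_group lamp_gens \<subseteq> carrier (lamp_group :: 's lamp monoid)"
      using lamp.generate_incl[OF gens] .
    show "carrier (lamp_group :: 's lamp monoid) \<subseteq> generate lamp_group lamp_gens"
    proof
      fix g :: "'s lamp" assume g: "g \<in> carrier lamp_group"
      then obtain n where "bounded_by n g" using bounded_by_exists by blast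
      then show "g \<in> generate lamp_group lamp_gens"
        using lamp.word_value_in_generate[OF lamp_nf_in_gens[OF g]] word_value_lamp_nf by metis
    qed
  qed
qed

lemma lamp_nf_cong:
  assumes "bounded_by m g" "bounded_by n g"
  shows "lamp_nf m g = lamp_nf n g"
  using lamp_nf_mono[OF assms(1), of "max m n"] lamp_nf_mono[OF assms(2), of "max m n"] by simp

theorem has_logspace_normal_form_lamp_group:
  "has_logspace_normal_form (lamp_group :: 's::finite lamp monoid)"
proof -
  let ?f = "\<lambda>w :: 's lamp list. lamp_nf (length w) (word_value lamp_group w)"
  let ?L = "?f ` lists lamp_gens"
  have val: "word_value lamp_group (?f w) = word_value lamp_group w"
    if "w \<in> lists lamp_gens" for w :: "'s lamp list"
    by (rule word_value_lamp_nf[OF bounded_by_word_value[OF that]])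
  have closed: "word_value lamp_group w \<in> carrier lamp_group"
    if "w \<in> lists lamp_gens" for w :: "'s lamp list"
    using that lamp_gens_carrier by (intro lamp.word_value_closed) auto
  have "inj_on (word_value lamp_group) ?L"
  proof (rule inj_onI)
    fix u v assume "u \<in> ?L" "v \<in> ?L" and eq: "word_value lamp_group u = word_value lamp_group v"
    then obtain u' v' where *: "u' \<in> lists lamp_gens" "u = ?f u'" "v' \<in> lists lamp_gens" "v = ?f v'"
      by blast
    then have eq': "word_value lamp_group u' = word_value lamp_group v'" using eq val by simp
    then have "bounded_by (length u') (word_value lamp_group v')"
      using bounded_by_word_value[OF *(1)] by simp
    from lamp_nf_cong[OF this bounded_by_word_value[OF *(3)]]
    show "u = v" using *(2,4) eq' by simp
  qed
  moreover have "word_value lamp_group ` ?L = carrier lamp_group"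
  proof
    show "word_value lamp_group ` ?L \<subseteq> carrier lamp_group"
      unfolding image_image by (rule image_subsetI) (simp only: val closed)
    show "carrier lamp_group \<subseteq> word_value lamp_group ` ?L"
    proof
      fix g :: "'s lamp" assume g: "g \<in> carrier lamp_group"
      then obtain n where "bounded_by n g" using bounded_by_exists by blast
      then have "g = word_value lamp_group (?f (lamp_nf n g))"
        using val[OF lamp_nf_in_gens[OF g]] word_value_lamp_nf by metis
      then show "g \<in> word_value lamp_group ` ?L" using lamp_nf_in_gens[OF g] by blast
    qed
  qed
  moreover have "?L \<subseteq> lists lamp_gens" using lamp_nf_in_gens[OF closed] by blast
  ultimately have "normal_form lamp_group lamp_gens ?L"
    by (simp add: normal_form_def bij_betw_def)
  then have "logspace_normal_form_function lamp_group lamp_gens ?f"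
    unfolding logspace_normal_form_function_def
    using lamp_nf_logspace_computable val by blast
  then show ?thesis
    unfolding has_logspace_normal_form_def
    using finite_symmetric_generating_set_lamp_gens by blast
qed

section \<open>Transport to a group on the natural numbers\<close>

lemma (in group) group_hom_image_group:
  assumes "inj_on e (carrier G)"
  shows "group_hom G (image_group e G) e"
proof -
  have iso: "e \<in> iso G (image_group e G)" by (rule inj_imp_image_group_iso[OF assms])
  then have "group (image_group e G)"
    using iso_imp_img_group[OF iso] by (simp add: image_group_def)
  then show ?thesis
    using iso group_axioms by (simp add: group_hom_def group_hom_axioms_def iso_def)
qed

lemma (in group_hom) word_value_hom:
  "set w \<subseteq> carrier G \<Longrightarrow> word_value H (map h w) = h (word_value G w)"
  by (induction w) simp_all

text \<open>
  The transported group has the renamed generators and the renamed normal forms. A machine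
  absorbs the renaming in its transition function, letter by letter.
\<close>

theorem (in group) has_logspace_normal_form_image_group:
  assumes inj: "inj_on e (carrier G)" and nf: "has_logspace_normal_form G"
  shows "has_logspace_normal_form (image_group e G)"
proof -
  let ?H = "image_group e G"
  interpret e: group_hom G ?H e by (rule group_hom_image_group[OF inj])
  obtain X f where "finite_symmetric_generating_set G X" "logspace_normal_form_function G X f"
    using nf unfolding has_logspace_normal_form_def by blast
  then obtain L where X: "finite X" "X \<subseteq> carrier G" "\<forall>x\<in>X. inv x \<in> X" "generate G X = carrier G"
    and comp: "logspace_computable X X f" and L: "L \<subseteq> lists X" "bij_betw (word_value G) L (carrier G)"
    and f: "\<forall>w\<in>lists X. f w \<in> L \<and> word_value G (f w) = word_value G w"
    unfolding finite_symmetric_generating_set_def logspace_normal_form_function_def normal_form_def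
    by (elim conjE exE) simp
  let ?d = "inv_into (carrier G) e"
  let ?f = "\<lambda>w. map e (f (map ?d w))"
  have d: "?d (e x) = x" if "x \<in> X" for x using that X(2) inj by (simp add: subset_iff)
  have val: "word_value ?H (map e w) = e (word_value G w)" if "w \<in> lists X" for w
    using that X(2) by (intro e.word_value_hom) auto
  have "finite_symmetric_generating_set ?H (e ` X)"
    unfolding finite_symmetric_generating_set_def
  proof (intro conjI)
    show "generate ?H (e ` X) = carrier ?H"
      using e.generate_img[OF X(2)] X(4) by (simp add: image_group_carrier)
    show "\<forall>y\<in>e ` X. inv\<^bsub>?H\<^esub> y \<in> e ` X"
      using X(2,3) by (simp add: subset_iff flip: e.hom_inv)
  qed (use X(1,2) in \<open>auto simp: image_group_carrier\<close>)
  moreover have "logspace_computable (e ` X) (e ` X) ?f"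
  proof -
    obtain M :: "(nat, nat, 'a, 'a) transducer"
      where "logspace_transducer X X M" "\<forall>w\<in>lists X. outputs M w (f w)"
      using comp unfolding logspace_computable_def by blast
    then show ?thesis by (rule logspace_computable_relabel) (use d in auto)
  qed
  moreover have "normal_form ?H (e ` X) (map e ` L)"
    unfolding normal_form_def
  proof
    show "map e ` L \<subseteq> lists (e ` X)" using L(1) by fastforce
    have *: "bij_betw (map e) L (map e ` L)"
      by (rule inj_on_imp_bij_betw)
        (use L(1) X(2) in \<open>auto intro!: inj_onI map_inj_on[OF _ inj_on_subset[OF inj]]\<close>)
    have "bij_betw (e \<circ> word_value G) L (carrier ?H)"
      using L(2) inj by (auto intro: bij_betw_trans inj_on_imp_bij_betw simp: image_group_carrier)
    then have "bij_betw (word_value ?H \<circ> map e) L (carrier ?H)"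
      by (rule bij_betw_cong[THEN iffD1, rotated]) (simp add: val[OF subsetD[OF L(1)]])
    then show "bij_betw (word_value ?H) (map e ` L) (carrier ?H)"
      using bij_betw_comp_iff[OF *] by blast
  qed
  moreover have "?f w \<in> map e ` L \<and> word_value ?H (?f w) = word_value ?H w"
    if w: "w \<in> lists (e ` X)" for w
  proof -
    obtain u where u: "u \<in> lists X" "w = map e u" using w by (auto simp: lists_image)
    have "map ?d w = u" unfolding u(2) map_map by (intro map_idI) (use u(1) d in auto)
    then show ?thesis using f u(1) val[OF u(1)] val[of "f u"] L(1) u(2) by auto
  qed
  ultimately show ?thesis
    unfolding has_logspace_normal_form_def logspace_normal_form_function_def by blast
qed

lemma (in group) finitely_generated_if_logspace_normal_form:
  assumes "has_logspace_normal_form G"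
  shows "finitely_generated_group G"
  using assms is_group unfolding has_logspace_normal_form_def finitely_generated_group_def
    finite_symmetric_generating_set_def by blast

lemma countable_carrier_if_logspace_normal_form:
  assumes "has_logspace_normal_form G"
  shows "countable (carrier G)"
proof -
  obtain X f where "finite_symmetric_generating_set G X" "logspace_normal_form_function G X f"
    using assms unfolding has_logspace_normal_form_def by blast
  then obtain L where "finite X" "L \<subseteq> lists X" "bij_betw (word_value G) L (carrier G)"
    unfolding finite_symmetric_generating_set_def logspace_normal_form_function_def normal_form_def
    by (elim conjE exE) simp
  then show ?thesis
    by (metis bij_betw_imp_surj_on countable_finite countable_image countable_lists countable_subset)
qed

text \<open>
  A lamp moved by \<open>k > 0\<close> positions commutes with all lamps at position \<open>0\<close>, but two lamps at position
  \<open>0\<close> need not commute.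
\<close>

lemma not_residually_finite_lamp_image:
  assumes inj: "inj_on e (carrier (lamp_group :: 's lamp monoid))"
    and gh: "bij g" "bij h" "g \<circ> h \<noteq> (h \<circ> g :: 's \<Rightarrow> 's)"
  shows "\<not> residually_finite (image_group e lamp_group)"
proof -
  let ?H = "image_group e lamp_group"
  interpret e: group_hom lamp_group ?H e by (rule lamp.group_hom_image_group[OF inj])
  let ?t = "shift 1 :: 's lamp" and ?a = "lamp_at 0 g" and ?b = "lamp_at 0 h"
  note carr = shift_carrier[of 1] lamp_at_carrier[OF gh(1), of 0] lamp_at_carrier[OF gh(2), of 0]
  note lamp_mult [simp del] lamp_one [simp del]
  show ?thesis
  proof (rule not_residually_finite_if_conjugates_commute)
    show "group ?H" by (rule e.H.is_group)
    show "e ?t \<in> carrier ?H" "e ?a \<in> carrier ?H" "e ?b \<in> carrier ?H"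
      using carr by simp_all
    show "e ?a \<otimes>\<^bsub>?H\<^esub> e ?b \<noteq> e ?b \<otimes>\<^bsub>?H\<^esub> e ?a"
    proof
      assume "e ?a \<otimes>\<^bsub>?H\<^esub> e ?b = e ?b \<otimes>\<^bsub>?H\<^esub> e ?a"
      then have "e (?a \<otimes>\<^bsub>lamp_group\<^esub> ?b) = e (?b \<otimes>\<^bsub>lamp_group\<^esub> ?a)" using carr by simp
      then have "?a \<otimes>\<^bsub>lamp_group\<^esub> ?b = ?b \<otimes>\<^bsub>lamp_group\<^esub> ?a"
        by (rule inj_onD[OF inj]) (use carr in \<open>simp_all only: lamp.m_closed\<close>)
      then show False using gh(3) by (auto simp: lamp_mult lamp_at_def dest: fun_cong[of _ _ 0])
    qed
    fix k :: nat assume "k > 0"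
    let ?c = "?t [^]\<^bsub>lamp_group\<^esub> k \<otimes>\<^bsub>lamp_group\<^esub> ?b \<otimes>\<^bsub>lamp_group\<^esub> inv\<^bsub>lamp_group\<^esub> (?t [^]\<^bsub>lamp_group\<^esub> k)"
    have "?c = lamp_at (int k) h"
      using conjugate_lamp_at[of "int k" 0 h] by (simp add: shift_power inv_shift)
    then have "?a \<otimes>\<^bsub>lamp_group\<^esub> ?c = ?c \<otimes>\<^bsub>lamp_group\<^esub> ?a"
      using lamp_at_commute[of 0 "int k" g h] \<open>k > 0\<close> by simp
    then have "e (?a \<otimes>\<^bsub>lamp_group\<^esub> ?c) = e (?c \<otimes>\<^bsub>lamp_group\<^esub> ?a)" by simp
    then show "e ?a \<otimes>\<^bsub>?H\<^esub> (e ?t [^]\<^bsub>?H\<^esub> k \<otimes>\<^bsub>?H\<^esub> e ?b \<otimes>\<^bsub>?H\<^esub> inv\<^bsub>?H\<^esub> (e ?t [^]\<^bsub>?H\<^esub> k)) =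
        (e ?t [^]\<^bsub>?H\<^esub> k \<otimes>\<^bsub>?H\<^esub> e ?b \<otimes>\<^bsub>?H\<^esub> inv\<^bsub>?H\<^esub> (e ?t [^]\<^bsub>?H\<^esub> k)) \<otimes>\<^bsub>?H\<^esub> e ?a"
      using carr by (simp add: e.hom_nat_pow[symmetric])
  qed
qed

theorem corollary24:
  shows "\<exists>G :: nat monoid.
    finitely_generated_group G \<and> has_logspace_normal_form G \<and> \<not> residually_finite G"
proof -
  let ?W = "lamp_group :: (bool \<times> bool) lamp monoid"
  let ?e = "to_nat_on (carrier ?W)"
  let ?G = "image_group ?e ?W"
  have nf: "has_logspace_normal_form ?W" by (rule has_logspace_normal_form_lamp_group)
  have inj: "inj_on ?e (carrier ?W)"
    by (rule inj_on_to_nat_on[OF countable_carrier_if_logspace_normal_form[OF nf]])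
  have nf': "has_logspace_normal_form ?G"
    by (rule lamp.has_logspace_normal_form_image_group[OF inj nf])
  interpret e: group_hom ?W ?G ?e by (rule lamp.group_hom_image_group[OF inj])
  \<comment> \<open>These two permutations generate the dihedral group of order \<open>8\<close> on four points.\<close>
  have "bij (apfst Not :: bool \<times> bool \<Rightarrow> _)" by (rule o_bij[of "apfst Not"]) auto
  moreover have "bij (prod.swap :: bool \<times> bool \<Rightarrow> _)" by simp
  moreover have "apfst Not \<circ> prod.swap \<noteq> (prod.swap \<circ> apfst Not :: bool \<times> bool \<Rightarrow> _)"
    by (auto simp: fun_eq_iff)
  ultimately have "\<not> residually_finite ?G"
    by (rule not_residually_finite_lamp_image[OF inj])
  then show ?thesis
    using nf' e.H.finitely_generated_if_logspace_normal_form[OF nf'] by blast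
qed

end
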